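(* Let $s\in\mathbb{N}$ and $n\in\mathbb{N}_0$. A function $f\in\mathcal{F}_{s,n}$ is completely monotone if and only if $(T^{s,n}\varphi_A)^{-1}(f)\in\mathrm{Psd}_{s,n}$. In particular, the set $\mathrm{CM}_{s,n}$ of completely monotone functions in $\mathcal{F}_{s,n}$ is a semi-algebraic cone in the finite-dimensional real vector space $\mathcal{F}_{s,n}$.
   Context: A smooth function $f:\mathbb{R}_{>0}^s\to\mathbb{R}$ is completely monotone if $\prod_{i=1}^s\left(-\frac{\partial}{\partial x_i}\right)^{\alpha_i}f(x)\ge 0$ for all $\alpha\in\mathbb{N}_0^s$ and all $x\in\mathbb{R}_{>0}^s$. $\mathbb{R}[\mathbf{y}]_n$ is the real vector space of polynomials in $y_1,\ldots,y_s$ of total degree at most $n$, and $\mathrm{Psd}_{s,n}\subseteq\mathbb{R}[\mathbf{y}]_n$ is the cone of those that are non-negative on $\mathbb{R}^s$. $\mathcal{F}_{s,n}$ is the real vector space of functions $f:\mathbb{R}_{>0}^s\to\mathbb{R}$ of the form $f(x)=\frac{p(\log x_1,\ldots,\log x_s)}{x_1\cdots x_s}$ with $p\in\mathbb{R}[\mathbf{y}]_n$. A subset of $\mathcal{F}_{s,n}$ is semi-algebraic if it is semi-algebraic in the coordinates given by the coefficients of $p$ (i.e. a finite union of sets, each given by finitely many polynomial equations and inequalities in these coefficients). For $l\in\mathbb{N}_0$ put $g_l:=\left.\left(\frac{d}{dz}\right)^l\Gamma(z)\right|_{z=1}$ with $\Gamma$ the gamma function. The linear map $\varphi_A:\mathbb{R}[y]_n\to\mathcal{F}_{1,n}$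 (where $\mathbb{R}[y]_n$ denotes univariate polynomials of degree at most $n$) is given on monomials by $\varphi_A(y^k)(x)=\sum_{m=0}^k(-1)^m\binom{k}{m}g_{k-m}\frac{\log(x)^m}{x}$ for $0\le k\le n$. The linear map $T^{s,n}\varphi_A:\mathbb{R}[\mathbf{y}]_n\to\mathcal{F}_{s,n}$ sends each monomial $y_1^{\lambda_1}\cdots y_s^{\lambda_s}$ with $\sum_i\lambda_i\le n$ to the function $(x_1,\ldots,x_s)\mapsto\prod_{j=1}^s\varphi_A(y^{\lambda_j})(x_j)$; it is an isomorphism of vector spaces. *)

theory Defs
  imports
    "HOL-Analysis.Analysis"
    "HOL-Computational_Algebra.Polynomial"
    "HOL-Library.Poly_Mapping"
    "HOL-Library.Function_Algebras"
begin

text \<open>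
  Throughout, the number of variables is \<open>s = CARD('s)\<close> for a finite index type \<open>'s\<close>.
  A function on the open positive orthant is represented by its extension by 0 to the whole
  of \<open>real ^ 's\<close> (respectively \<open>real\<close>), so that equality of representatives is equality of
  functions on the orthant and the pointwise operations are the right ones.
\<close>

instantiation "fun" :: (type, real_vector) real_vector
begin

definition scaleR_fun :: "real \<Rightarrow> ('a \<Rightarrow> 'b) \<Rightarrow> 'a \<Rightarrow> 'b" where
  "scaleR_fun c f = (\<lambda>x. c *\<^sub>R f x)"

instance
  by intro_classes
    (simp_all add: scaleR_fun_def fun_eq_iff scaleR_add_right scaleR_add_left)

end

definition orthant :: "(real ^ 's::finite) set" where
  "orthant = {x. \<forall>i. x $ i > 0}"


section \<open>Polynomials in several variables\<close>

text \<open>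
  A monomial is the finitely supported map of its exponents, a polynomial the finitely supported
  map from monomials to coefficients.
\<close>

type_synonym 'v mpoly = "('v \<Rightarrow>\<^sub>0 nat) \<Rightarrow>\<^sub>0 real"

definition mono_degree :: "('v \<Rightarrow>\<^sub>0 nat) \<Rightarrow> nat" where
  "mono_degree m = (\<Sum>i\<in>Poly_Mapping.keys m. Poly_Mapping.lookup m i)"

definition mpoly_eval :: "'v mpoly \<Rightarrow> ('v \<Rightarrow> real) \<Rightarrow> real" where
  "mpoly_eval p a =
     (\<Sum>m\<in>Poly_Mapping.keys p. Poly_Mapping.lookup p m *
        (\<Prod>i\<in>Poly_Mapping.keys m. a i ^ Poly_Mapping.lookup m i))"

definition mpoly_vars :: "'v mpoly \<Rightarrow> 'v set" where
  "mpoly_vars p = (\<Union>m\<in>Poly_Mapping.keys p. Poly_Mapping.keys m)"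

definition mpolys_le :: "nat \<Rightarrow> 's::finite mpoly set" where
  "mpolys_le n = {p. \<forall>m\<in>Poly_Mapping.keys p. mono_degree m \<le> n}"

definition Psd :: "nat \<Rightarrow> 's::finite mpoly set" where
  "Psd n = {p \<in> mpolys_le n. \<forall>y :: real ^ 's. mpoly_eval p (\<lambda>i. y $ i) \<ge> 0}"


section \<open>Completely monotone functions\<close>

definition partial_deriv :: "'s::finite \<Rightarrow> (real ^ 's \<Rightarrow> real) \<Rightarrow> real ^ 's \<Rightarrow> real" where
  "partial_deriv i f x = deriv (\<lambda>t. f (x + t *\<^sub>R axis i 1)) 0"

text \<open>
  Smoothness on an open set: iterated partial derivatives, in any order \<open>is\<close>, exist
  and are continuous.
\<close>

definition smooth_on :: "(real ^ 's::finite) set \<Rightarrow> (real ^ 's \<Rightarrow> real) \<Rightarrow> bool" where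
  "smooth_on U f \<longleftrightarrow>
     (\<forall>is. continuous_on U (foldr partial_deriv is f) \<and>
       (\<forall>i. \<forall>x\<in>U. (\<lambda>t. foldr partial_deriv is f (x + t *\<^sub>R axis i 1)) field_differentiable (at 0)))"

text \<open>
  Some enumeration of the coordinates, needed to write down the composition
  \<open>\<Prod>\<^sub>i (- \<partial>/\<partial>x\<^sub>i) ^ \<alpha>\<^sub>i\<close>. For smooth functions the factors commute, so the choice is irrelevant.
\<close>

definition coords :: "'s::finite list" where
  "coords = (SOME is. set is = UNIV \<and> distinct is)"

definition alt_deriv :: "('s::finite \<Rightarrow> nat) \<Rightarrow> (real ^ 's \<Rightarrow> real) \<Rightarrow> real ^ 's \<Rightarrow> real" where
  "alt_deriv \<alpha> f = foldr (\<lambda>i. (\<lambda>g x. - partial_deriv i g x) ^^ \<alpha> i) coords f"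

definition completely_monotone :: "(real ^ 's::finite \<Rightarrow> real) \<Rightarrow> bool" where
  "completely_monotone f \<longleftrightarrow>
     smooth_on orthant f \<and> (\<forall>\<alpha>. \<forall>x\<in>orthant. alt_deriv \<alpha> f x \<ge> 0)"


section \<open>The function space\<close>

definition log_fun :: "'s::finite mpoly \<Rightarrow> real ^ 's \<Rightarrow> real" where
  "log_fun p = (\<lambda>x. if x \<in> orthant then mpoly_eval p (\<lambda>i. ln (x $ i)) / (\<Prod>i\<in>UNIV. x $ i) else 0)"

definition log_space :: "nat \<Rightarrow> (real ^ 's::finite \<Rightarrow> real) set" where
  "log_space n = log_fun ` mpolys_le n"

definition CM :: "nat \<Rightarrow> (real ^ 's::finite \<Rightarrow> real) set" where
  "CM n = {f \<in> log_space n. completely_monotone f}"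


section \<open>Semi-algebraic sets\<close>

text \<open>
  For a finite set \<open>I\<close>, the space \<open>real\<^sup>I\<close> is represented by the functions that vanish outside \<open>I\<close>.
  Each pair \<open>(E, G)\<close> describes one piece, with equations \<open>q = 0\<close> for \<open>q \<in> E\<close> and inequalities
  \<open>q > 0\<close> for \<open>q \<in> G\<close>; a weak inequality is a union of two such conditions.
\<close>

definition semialgebraic_on :: "'v set \<Rightarrow> ('v \<Rightarrow> real) set \<Rightarrow> bool" where
  "semialgebraic_on I S \<longleftrightarrow>
     (\<exists>\<P> :: ('v mpoly set \<times> 'v mpoly set) set.
        finite \<P> \<and>
        (\<forall>(E, G)\<in>\<P>. finite E \<and> finite G \<and> (\<forall>q\<in>E \<union> G. mpoly_vars q \<subseteq> I)) \<and>
        S = (\<Union>(E, G)\<in>\<P>. {a. (\<forall>v. v \<notin> I \<longrightarrow> a v = 0) \<and>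
                                (\<forall>q\<in>E. mpoly_eval q a = 0) \<and> (\<forall>q\<in>G. mpoly_eval q a > 0)}))"

definition semialgebraic_in_log_space :: "nat \<Rightarrow> (real ^ 's::finite \<Rightarrow> real) set \<Rightarrow> bool" where
  "semialgebraic_in_log_space n S \<longleftrightarrow>
     S \<subseteq> log_space n \<and>
     semialgebraic_on {m. mono_degree m \<le> n}
       (Poly_Mapping.lookup ` {p \<in> mpolys_le n. log_fun p \<in> S})"


section \<open>The linear map\<close>

definition gamma_deriv :: "nat \<Rightarrow> real" where
  "gamma_deriv l = (deriv ^^ l) Gamma 1"

definition phi_A :: "real poly \<Rightarrow> real \<Rightarrow> real" where
  "phi_A p = (\<lambda>x. if x > 0 then
     (\<Sum>k\<le>degree p. coeff p k *
        (\<Sum>m\<le>k. (-1) ^ m * real (k choose m) * gamma_deriv (k - m) * (ln x ^ m / x)))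
     else 0)"

text \<open>
  The map \<open>T\<^sup>s\<^sup>,\<^sup>n \<phi>\<close> is the restriction of the following map to \<open>mpolys_le n\<close>. For
  \<open>\<phi> = phi_A\<close> the value vanishes off the orthant because some factor does.
\<close>

definition tensor_map ::
  "(real poly \<Rightarrow> real \<Rightarrow> real) \<Rightarrow> 's::finite mpoly \<Rightarrow> real ^ 's \<Rightarrow> real" where
  "tensor_map \<phi> p = (\<lambda>x. \<Sum>m\<in>Poly_Mapping.keys p. Poly_Mapping.lookup p m *
     (\<Prod>j\<in>UNIV. \<phi> (monom 1 (Poly_Mapping.lookup m j)) (x $ j)))"

end

theory Submission
  imports Defs
begin

text \<open>
  Substituting \<open>t = u x\<close> in the integral for the derivatives of Gamma gives
  \<open>phi_A (y ^ l) (x) = \<integral> (ln u) ^ l exp (- u x) du\<close> over \<open>u > 0\<close>, so the tensor map sends \<open>q\<close> to the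
  Laplace transform of \<open>q (ln u)\<close> on the orthant, and its derivatives of order \<open>\<alpha>\<close> are, up to sign,
  the Laplace transforms of \<open>u ^ \<alpha> q (ln u)\<close>. Hence \<open>q \<ge> 0\<close> implies complete monotonicity. Conversely,
  the derivatives of order \<open>(k, ..., k)\<close> at \<open>x\<^sub>i = k exp (- y\<^sub>i)\<close>, suitably normalised, integrate
  \<open>q (ln u)\<close> against gamma densities that concentrate at \<open>u = exp y\<close>, and so converge to \<open>q (y)\<close>.
  The same limit shows that the tensor map is injective.

  Semi-algebraicity is quantifier elimination over the reals in the manner of Cohen and Hoermander:
  finitely many polynomial expressions in the parameters determine, by their signs, the order in
  which the roots of a family of univariate polynomials interlace, and thus all sign conditions
  realised on \<open>[-1, 1]\<close>. Homogenisation reduces positivity on the whole space to that on a cube.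
\<close>

section \<open>Quantifier elimination on a compact interval\<close>

text \<open>The obstacle is the quantifier over all real points in the positivity condition. No
  quantifier-free formula is computed: it is enough that truth is unchanged as long as finitely many
  polynomials in the parameters keep their signs, since finitely many functions have only finitely
  many sign vectors and each of these gives one piece of a semi-algebraic set. For one bound
  variable, two parameter points are compared by an increasing bijection of the line that carries
  the signs of one specialised family to those of the other. Working on \<open>[-1, 1]\<close>
  replaces the behaviour at infinity by two endpoint values, which are again polynomials in the
  parameters. The parameters are the coefficients of \<open>p\<close>, whereas positivity concerns
  the preimage of \<open>log_fun p\<close>. This preimage depends linearly on \<open>p\<close>,
  because the univariate map is triangular on the powers of the logarithm with diagonal entries
  \<open>(-1) ^ l\<close>; hence the condition stays polynomial in the parameters.\<close>

text \<open>Serves to correct one value of an increasing bijection without disturbing the others,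
  which lie outside the interval.\<close>

lemma order_iso_move_point:
  fixes a b u v :: real
  assumes "a < u" "u < b" "a < v" "v < b"
  obtains \<psi> :: "real \<Rightarrow> real"
  where "strict_mono \<psi>" "surj \<psi>" "\<psi> u = v" "\<And>t. t \<notin> {a<..<b} \<Longrightarrow> \<psi> t = t"
proof -
  \<comment> \<open>The slopes of the two affine pieces that join \<open>(a, a)\<close>,
    \<open>(u, v)\<close> and \<open>(b, b)\<close>.\<close>
  define \<alpha> \<beta> where "\<alpha> = (v - a) / (u - a)" and "\<beta> = (b - v) / (b - u)"
  have pos: "\<alpha> > 0" "\<beta> > 0" using assms by (auto simp: \<alpha>_def \<beta>_def)
  have eq: "\<alpha> * (u - a) = v - a" "\<beta> * (b - u) = b - v" using assms by (auto simp: \<alpha>_def \<beta>_def)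
  define \<psi> where "\<psi> t = (if t \<le> a \<or> t \<ge> b then t else if t \<le> u then a + \<alpha> * (t - a) else b - \<beta> * (b - t))" for t
  have lt1: "\<alpha> * (s - a) < \<alpha> * (t - a)" if "s < t" for s t using that pos by simp
  have lt2: "\<beta> * (b - t) < \<beta> * (b - s)" if "s < t" for s t using that pos by simp
  have le1: "\<alpha> * (s - a) \<le> v - a" if "s \<le> u" for s
    using mult_left_mono[of "s - a" "u - a" \<alpha>] that pos eq by simp
  have le2: "\<beta> * (b - t) < b - v" if "u < t" for t using lt2[OF that] eq by simp
  have p1: "0 < \<alpha> * (t - a)" if "a < t" for t using that pos by simp
  have p2: "0 < \<beta> * (b - t)" if "t < b" for t using that pos by simp
  have "strict_mono \<psi>"
  proof (rule strict_monoI)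
    fix s t :: real assume "s < t"
    then show "\<psi> s < \<psi> t"
      using lt1[of s t] lt2[of s t] le1[of s] le2[of t] le1[of t] le2[of s] p1[of s] p1[of t] p2[of t] p2[of s] assms
      unfolding \<psi>_def by (auto split: if_splits)
  qed
  moreover have "surj \<psi>"
  proof (rule surjI)
    fix s
    show "\<psi> (if s \<le> a \<or> s \<ge> b then s else if s \<le> v then a + (s - a) / \<alpha> else b - (b - s) / \<beta>) = s"
      (is "\<psi> ?t = s")
    proof -
      consider "s \<le> a \<or> s \<ge> b" | "a < s" "s < b" "s \<le> v" | "a < s" "s < b" "v < s" by linarith
      then show ?thesis
      proof cases
        case 2
        then have "?t = a + (s - a) / \<alpha>" "(s - a) / \<alpha> > 0" "(s - a) / \<alpha> \<le> u - a"
          using pos eq by (auto simp: field_simps)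
        then show ?thesis using assms pos by (simp add: \<psi>_def)
      next
        case 3
        then have "?t = b - (b - s) / \<beta>" "(b - s) / \<beta> > 0" "(b - s) / \<beta> < b - u"
          using pos eq by (auto simp: field_simps)
        then show ?thesis using assms pos by (simp add: \<psi>_def)
      qed (auto simp: \<psi>_def)
    qed
  qed
  moreover have "\<psi> u = v" using assms eq by (simp add: \<psi>_def)
  moreover have "\<psi> t = t" if "t \<notin> {a<..<b}" for t using that by (auto simp: \<psi>_def)
  ultimately show ?thesis using that by blast
qed

text \<open>Induction on \<open>W\<close>: a bijection that is right on the old points is followed
  by one that moves only the new value. The extension to the whole line lets every point be
  transported, not only those of \<open>W\<close>.\<close>

lemma strict_mono_extend_finite:
  fixes \<sigma> :: "real \<Rightarrow> real"
  assumes "finite W" "strict_mono_on W \<sigma>"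
  shows "\<exists>k. strict_mono k \<and> surj k \<and> (\<forall>w\<in>W. k w = \<sigma> w)"
  using assms
proof (induction W rule: finite_induct)
  case empty
  show ?case by (rule exI[of _ id]) (auto simp: strict_mono_def)
next
  case (insert w W)
  have "strict_mono_on W \<sigma>" using insert.prems by (auto simp: strict_mono_on_def)
  with insert.IH obtain k where k: "strict_mono k" "surj k" "\<And>z. z \<in> W \<Longrightarrow> k z = \<sigma> z" by blast
  define u v where "u = k w" and "v = \<sigma> w"
  have sep: "(z < w \<longrightarrow> k z < u \<and> k z < v) \<and> (w < z \<longrightarrow> u < k z \<and> v < k z)" if "z \<in> W" for z
    using that strict_monoD[OF k(1), of z w] strict_monoD[OF k(1), of w z] k(3)[OF that]
      strict_mono_onD[OF insert.prems, of z w] strict_mono_onD[OF insert.prems, of w z]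
    unfolding u_def v_def by auto
  \<comment> \<open>The values of \<open>k\<close> on \<open>W\<close> that are closest to both
    \<open>u\<close> and \<open>v\<close> from either side; no such value lies between
    \<open>u\<close> and \<open>v\<close>. The inserted numbers keep the maximum and the minimum
    from being taken over the empty set.\<close>
  define a where "a = Max (insert (min u v - 1) {y \<in> k ` W. y < min u v})"
  define b where "b = Min (insert (max u v + 1) {y \<in> k ` W. y > max u v})"
  have "a \<in> insert (min u v - 1) {y \<in> k ` W. y < min u v}"
    unfolding a_def using insert.hyps by (intro Max_in) auto
  then have a: "a < min u v" by auto
  have "b \<in> insert (max u v + 1) {y \<in> k ` W. y > max u v}"
    unfolding b_def using insert.hyps by (intro Min_in) auto
  then have b: "b > max u v" by auto
  have out: "k z \<notin> {a<..<b}" if "z \<in> W" for z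
  proof (cases "z < w")
    case True
    then have "k z \<le> a" unfolding a_def using insert.hyps that sep[OF that] by (intro Max_ge) auto
    then show ?thesis by auto
  next
    case False
    then have "w < z" using insert.hyps that by (metis linorder_neqE)
    then have "k z \<ge> b" unfolding b_def using insert.hyps that sep[OF that] by (intro Min_le) auto
    then show ?thesis by auto
  qed
  obtain \<psi> where \<psi>: "strict_mono \<psi>" "surj \<psi>" "\<psi> u = v" "\<And>t. t \<notin> {a<..<b} \<Longrightarrow> \<psi> t = t"
    using order_iso_move_point[of a u b v] a b by auto
  have "strict_mono (\<psi> \<circ> k)" using \<psi> k by (auto simp: strict_mono_def)
  moreover have "surj (\<psi> \<circ> k)" using \<psi> k by (intro comp_surj) auto
  moreover have "\<forall>z\<in>insert w W. (\<psi> \<circ> k) z = \<sigma> z"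
    using \<psi>(3,4) out k(3) by (auto simp: u_def v_def)
  ultimately show ?case by blast
qed

lemma finite_set_neighbours:
  fixes Z :: "'a::linorder set"
  assumes "finite Z" "r \<notin> Z" "lo \<in> Z" "lo < r" "hi \<in> Z" "r < hi"
  obtains p q where "p \<in> Z" "q \<in> Z" "p < r" "r < q" "\<And>z. z \<in> Z \<Longrightarrow> z \<le> p \<or> q \<le> z"
proof -
  define p q where "p = Max {z \<in> Z. z < r}" and "q = Min {z \<in> Z. r < z}"
  have "p \<in> {z \<in> Z. z < r}" unfolding p_def using assms by (intro Max_in) auto
  moreover have "q \<in> {z \<in> Z. r < z}" unfolding q_def using assms by (intro Min_in) auto
  moreover have "z \<le> p \<or> q \<le> z" if "z \<in> Z" for z
  proof (cases "z < r")
    case True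
    then show ?thesis using that assms unfolding p_def by (intro disjI1 Max_ge) auto
  next
    case False
    then have "r < z" using that assms by (metis linorder_neqE)
    then show ?thesis using that assms unfolding q_def by (intro disjI2 Min_le) auto
  qed
  ultimately show ?thesis using that by blast
qed

section \<open>Signs and roots of real univariate polynomials\<close>

lemma poly_rolle:
  fixes f :: "real poly"
  assumes "a < b" "poly f a = poly f b"
  obtains z where "a < z" "z < b" "poly (pderiv f) z = 0"
  using poly_MVT[OF assms(1), of f] assms by auto

lemma poly_opposite_signs_root:
  fixes f :: "real poly"
  assumes "a < b" "poly f a * poly f b < 0"
  obtains z where "a < z" "z < b" "poly f z = 0"
  using poly_IVT[OF assms] by blast

lemma poly_same_sign:
  fixes f :: "real poly"
  assumes "\<And>z. min a b \<le> z \<Longrightarrow> z \<le> max a b \<Longrightarrow> poly f z \<noteq> 0"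
  shows "sgn (poly f a) = sgn (poly f b)"
proof (rule ccontr)
  assume ne: "sgn (poly f a) \<noteq> sgn (poly f b)"
  have "poly f a \<noteq> 0" "poly f b \<noteq> 0" using assms[of a] assms[of b] by auto
  with ne have neg: "poly f a * poly f b < 0" "poly f b * poly f a < 0"
    by (auto simp: sgn_real_def mult_less_0_iff split: if_splits)
  have "a \<noteq> b" using ne by auto
  then consider "a < b" | "b < a" by linarith
  then show False
  proof cases
    case 1
    then obtain z where "a < z" "z < b" "poly f z = 0" using poly_opposite_signs_root neg by blast
    then show False using assms[of z] by auto
  next
    case 2
    then obtain z where "b < z" "z < a" "poly f z = 0" using poly_opposite_signs_root neg by blast
    then show False using assms[of z] by auto
  qed
qed

text \<open>The derivative has constant sign on the open interval, so the mean value theorem on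
  either side of the root gives values of opposite sign. The derivative may vanish at
  \<open>p\<close> and \<open>q\<close>.\<close>

lemma sign_change_at_simple_root:
  fixes f :: "real poly"
  assumes "p < r" "r < q" "poly f r = 0"
    and crit: "\<And>t. p < t \<Longrightarrow> t < q \<Longrightarrow> poly (pderiv f) t \<noteq> 0"
  shows "poly f p * poly f q < 0"
proof -
  obtain x where x: "p < x" "x < r" "poly f r - poly f p = (r - p) * poly (pderiv f) x"
    using poly_MVT[OF \<open>p < r\<close>, of f] by blast
  obtain y where y: "r < y" "y < q" "poly f q - poly f r = (q - r) * poly (pderiv f) y"
    using poly_MVT[OF \<open>r < q\<close>, of f] by blast
  have "sgn (poly (pderiv f) x) = sgn (poly (pderiv f) y)"
    using crit x y assms by (intro poly_same_sign) auto
  moreover have "poly (pderiv f) x \<noteq> 0" using crit x assms by auto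
  ultimately have "poly (pderiv f) x * poly (pderiv f) y > 0"
    by (auto simp: sgn_real_def zero_less_mult_iff split: if_splits)
  moreover have "poly f p = - ((r - p) * poly (pderiv f) x)" "poly f q = (q - r) * poly (pderiv f) y"
    using x(3) y(3) assms(3) by simp_all
  then have "poly f p * poly f q = - ((r - p) * (q - r) * (poly (pderiv f) x * poly (pderiv f) y))"
    by simp
  ultimately show ?thesis using assms by simp
qed

text \<open>Between neighbouring points of \<open>Z\<close> the polynomial \<open>f\<close> is
  monotone, so a root there forces opposite signs at the neighbours. The images of the neighbours
  carry the same signs of \<open>g\<close>, and the intermediate value theorem gives a root of
  \<open>g\<close> in the corresponding gap. The lemma is used in both directions, the second time
  with \<open>inv h\<close> in place of \<open>h\<close>.\<close>

lemma root_transfer: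
  fixes f g :: "real poly"
  assumes Z: "finite Z" "-1 \<in> Z" "1 \<in> Z"
    and h: "strict_mono h"
    and crit: "\<And>t. t \<in> {-1..1} \<Longrightarrow> poly (pderiv f) t = 0 \<Longrightarrow> t \<in> Z"
    and sg: "\<And>z. z \<in> Z \<Longrightarrow> sgn (poly f z) = sgn (poly g (h z))"
    and r: "r \<in> {-1..1}" "poly f r = 0" "r \<notin> Z"
  shows "\<exists>u. poly g u = 0 \<and> u \<notin> h ` Z \<and> (\<forall>z\<in>Z. z < r \<longleftrightarrow> h z < u)"
proof -
  have "-1 < r" "r < 1" using r Z by (auto simp: order_le_less)
  then obtain p q where pq: "p \<in> Z" "q \<in> Z" "p < r" "r < q" "\<And>z. z \<in> Z \<Longrightarrow> z \<le> p \<or> q \<le> z"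
    using finite_set_neighbours[OF Z(1) r(3) Z(2) _ Z(3)] by blast
  have bd: "-1 \<le> p" "q \<le> 1" using pq(5)[OF Z(2)] pq(5)[OF Z(3)] \<open>-1 < r\<close> \<open>r < 1\<close> pq(3,4) by linarith+
  have "poly (pderiv f) t \<noteq> 0" if "p < t" "t < q" for t
    using crit[of t] pq(5)[of t] that bd by force
  then have "poly f p * poly f q < 0" using sign_change_at_simple_root[OF pq(3,4) r(2)] by blast
  then have "poly g (h p) * poly g (h q) < 0"
    using sg[OF pq(1)] sg[OF pq(2)] by (auto simp: sgn_real_def mult_less_0_iff split: if_splits)
  moreover have "h p < h q" using h pq(3,4) by (auto simp: strict_mono_def)
  ultimately obtain u where u: "h p < u" "u < h q" "poly g u = 0"
    using poly_opposite_signs_root by blast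
  have "(z < r \<longleftrightarrow> h z < u) \<and> u \<noteq> h z" if "z \<in> Z" for z
    using pq(5)[OF that] strict_mono_less_eq[OF h, of z p] strict_mono_less_eq[OF h, of q z] u pq(3,4) by force
  then show ?thesis using u(3) by blast
qed

text \<open>By Rolle each gap between points of \<open>Z\<close> contains at most one root of
  \<open>f\<close>, and likewise for \<open>g\<close> and the image of \<open>Z\<close> under
  \<open>h\<close>; by \<open>root_transfer\<close> in both directions these roots match. It remains
  to bend \<open>h\<close> so that it sends roots to roots, leaving it alone on
  \<open>Z\<close>.\<close>

lemma sign_iso_adjust:
  fixes f g :: "real poly"
  assumes Z: "finite Z" "Z \<subseteq> {-1..1}" "-1 \<in> Z" "1 \<in> Z"
    and h: "strict_mono h" "surj h" "h (-1) = -1" "h 1 = 1"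
    and critf: "\<And>t. t \<in> {-1..1} \<Longrightarrow> poly (pderiv f) t = 0 \<Longrightarrow> t \<in> Z"
    and critg: "\<And>t. t \<in> {-1..1} \<Longrightarrow> poly (pderiv g) t = 0 \<Longrightarrow> t \<in> h ` Z"
    and sg: "\<And>z. z \<in> Z \<Longrightarrow> sgn (poly f z) = sgn (poly g (h z))"
    and nz: "f \<noteq> 0"
  shows "\<exists>k. strict_mono k \<and> surj k \<and> (\<forall>z\<in>Z. k z = h z) \<and>
             (\<forall>t\<in>{-1..1}. sgn (poly f t) = sgn (poly g (k t)))"
proof -
  define Rt where "Rt = {t \<in> {-1..1}. poly f t = 0 \<and> t \<notin> Z}"
  have finRt: "finite Rt" unfolding Rt_def using poly_roots_finite[OF nz] by (rule rev_finite_subset) auto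
  have "\<forall>r\<in>Rt. \<exists>u. poly g u = 0 \<and> u \<notin> h ` Z \<and> (\<forall>z\<in>Z. z < r \<longleftrightarrow> h z < u)"
  proof
    fix r assume "r \<in> Rt"
    then show "\<exists>u. poly g u = 0 \<and> u \<notin> h ` Z \<and> (\<forall>z\<in>Z. z < r \<longleftrightarrow> h z < u)"
      using root_transfer[of Z h f g r] Z h critf sg by (auto simp: Rt_def)
  qed
  then obtain \<tau> where \<tau>: "\<And>r. r \<in> Rt \<Longrightarrow> poly g (\<tau> r) = 0" "\<And>r. r \<in> Rt \<Longrightarrow> \<tau> r \<notin> h ` Z"
      "\<And>r z. r \<in> Rt \<Longrightarrow> z \<in> Z \<Longrightarrow> z < r \<longleftrightarrow> h z < \<tau> r"
    by metis
  \<comment> \<open>The values prescribed for the new bijection on \<open>Z\<close> and on the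
    further roots of \<open>f\<close>.\<close>
  define \<sigma> where "\<sigma> t = (if t \<in> Z then h t else \<tau> t)" for t
  define W where "W = Z \<union> Rt"
  have gap: "z < r \<longleftrightarrow> h z < \<tau> r" "r < z \<longleftrightarrow> \<tau> r < h z" if "r \<in> Rt" "z \<in> Z" for r z
  proof -
    show 1: "z < r \<longleftrightarrow> h z < \<tau> r" using \<tau>(3) that by blast
    have "r \<noteq> z" "\<tau> r \<noteq> h z" using that \<tau>(2)[of r] by (auto simp: Rt_def)
    then show "r < z \<longleftrightarrow> \<tau> r < h z" using 1 by auto
  qed
  have "strict_mono_on W \<sigma>"
  proof (rule strict_mono_onI)
    fix s t assume st: "s \<in> W" "t \<in> W" "s < t"
    consider "s \<in> Z" "t \<in> Z" | "s \<in> Z" "t \<in> Rt" "t \<notin> Z" | "t \<in> Z" "s \<in> Rt" "s \<notin> Z"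
      | "t \<in> Rt" "s \<in> Rt" "s \<notin> Z" "t \<notin> Z"
      using st by (auto simp: W_def Rt_def)
    then show "\<sigma> s < \<sigma> t"
    proof cases
      case 1 then show ?thesis using h(1) st by (auto simp: \<sigma>_def strict_mono_def)
    next
      case 2 then show ?thesis using gap st by (auto simp: \<sigma>_def)
    next
      case 3 then show ?thesis using gap st by (auto simp: \<sigma>_def)
    next
      \<comment> \<open>By Rolle two such roots enclose a critical point of \<open>f\<close>, hence
        a point of \<open>Z\<close>, which also separates their images.\<close>
      case 4
      then obtain z where z: "s < z" "z < t" "poly (pderiv f) z = 0"
        using poly_rolle[OF st(3), of f] by (auto simp: Rt_def)
      then have "z \<in> Z" using critf[of z] 4 by (auto simp: Rt_def)
      then have "\<tau> s < h z" "h z < \<tau> t" using gap 4 z by blast+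
      then show ?thesis using 4 by (auto simp: \<sigma>_def)
    qed
  qed
  moreover have finW: "finite W" using Z finRt by (auto simp: W_def)
  ultimately obtain k where k: "strict_mono k" "surj k" "\<And>w. w \<in> W \<Longrightarrow> k w = \<sigma> w"
    using strict_mono_extend_finite[of W \<sigma>] by blast
  have kZ: "k z = h z" if "z \<in> Z" for z using that k(3)[of z] by (auto simp: W_def \<sigma>_def)
  have kR: "k r = \<tau> r" if "r \<in> Rt" for r using that k(3)[of r] by (auto simp: W_def \<sigma>_def Rt_def)
  have kle: "k s \<le> k t \<longleftrightarrow> s \<le> t" "k s < k t \<longleftrightarrow> s < t" for s t
    using k(1) by (auto simp: strict_mono_less strict_mono_less_eq)
  have hless: "h s < h t \<longleftrightarrow> s < t" for s t using h(1) by (simp add: strict_mono_less)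
  have kends: "k (-1) = -1" "k 1 = 1" using kZ Z h by auto
  have invh: "inv h (h t) = t" "h (inv h u) = u" for t u
    using strict_mono_imp_inj_on[OF h(1)] h(2) by (auto simp: surj_f_inv_f)
  \<comment> \<open>Otherwise \<open>g\<close> could vanish where \<open>f\<close> does not. A root
    of \<open>g\<close> off the image of \<open>Z\<close> comes with a root \<open>r\<close> of
    \<open>f\<close> in the corresponding gap, and Rolle for \<open>g\<close> forces it to be
    \<open>\<tau> r\<close>.\<close>
  have rootg: "t \<in> W" if t: "t \<in> {-1..1}" "poly g (k t) = 0" for t
  proof (cases "k t \<in> h ` Z")
    case True
    then obtain z where "z \<in> Z" "k t = k z" using kZ by auto
    then have "t = z" using kle(2) by (metis linorder_neqE less_irrefl)
    then show ?thesis using \<open>z \<in> Z\<close> by (auto simp: W_def)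
  next
    case False
    have mono: "strict_mono (inv h)"
      by (rule strict_monoI) (metis hless invh(2))
    have "k t \<in> {-1..1}" using t kle(1)[of "-1" t] kle(1)[of t 1] kends by auto
    have "\<exists>r. poly f r = 0 \<and> r \<notin> inv h ` h ` Z \<and> (\<forall>y\<in>h ` Z. y < k t \<longleftrightarrow> inv h y < r)"
    proof (rule root_transfer[OF _ _ _ mono critg])
      show "-1 \<in> h ` Z" "1 \<in> h ` Z" using Z h by (metis imageI)+
      show "sgn (poly g y) = sgn (poly f (inv h y))" if "y \<in> h ` Z" for y
        using that sg by (auto simp: invh)
    qed (use Z t False \<open>k t \<in> {-1..1}\<close> in auto)
    then obtain r where r: "poly f r = 0" "r \<notin> Z" "\<And>z. z \<in> Z \<Longrightarrow> h z < k t \<longleftrightarrow> z < r"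
      by (auto simp: invh image_image)
    have "-1 < k t" using False \<open>k t \<in> {-1..1}\<close> Z h by (metis atLeastAtMost_iff image_eqI order_le_less)
    then have "-1 < r" using r(3)[of "-1"] Z h by auto
    have "\<not> 1 < k t" using \<open>k t \<in> {-1..1}\<close> by auto
    then have "r \<le> 1" using r(3)[of 1] Z h by auto
    then have rR: "r \<in> Rt" using r \<open>-1 < r\<close> by (auto simp: Rt_def)
    have "k t = \<tau> r"
    proof (rule ccontr)
      assume ne: "k t \<noteq> \<tau> r"
      have inI: "\<tau> r \<in> {-1..1}"
        using kle(1)[of "-1" r] kle(1)[of r 1] kends \<open>-1 < r\<close> \<open>r \<le> 1\<close> kR[OF rR] by auto
      define lo hi where "lo = min (k t) (\<tau> r)" and "hi = max (k t) (\<tau> r)"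
      have "lo < hi" "poly g lo = poly g hi" using ne t(2) \<tau>(1)[OF rR]
        by (auto simp: lo_def hi_def min_def max_def)
      then obtain y where y: "lo < y" "y < hi" "poly (pderiv g) y = 0"
        using poly_rolle by blast
      have "y \<in> {-1..1}" using y inI \<open>k t \<in> {-1..1}\<close> by (auto simp: lo_def hi_def)
      then obtain z where z: "z \<in> Z" "y = h z" using critg y by blast
      have "h z < k t \<longleftrightarrow> h z < \<tau> r" using r(3)[OF z(1)] gap(1)[OF rR z(1)] by simp
      then show False using y z unfolding lo_def hi_def by (auto simp: min_def max_def split: if_splits)
    qed
    then have "k t = k r" using kR[OF rR] by simp
    then have "t = r" using kle(2) by (metis linorder_neqE less_irrefl)
    then show ?thesis using rR by (auto simp: W_def)
  qed
  have "sgn (poly f t) = sgn (poly g (k t))" if t: "t \<in> {-1..1}" for t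
  proof -
    have onW: "sgn (poly f w) = sgn (poly g (k w))" if "w \<in> W" for w
      using that kZ kR sg \<tau>(1) by (auto simp: W_def Rt_def)
    show ?thesis
    proof (cases "t \<in> W")
      case False
      then have "-1 < t" "t < 1" using t Z by (auto simp: W_def order_le_less)
      then obtain p q where pq: "p \<in> W" "q \<in> W" "p < t" "t < q" "\<And>z. z \<in> W \<Longrightarrow> z \<le> p \<or> q \<le> z"
        using finite_set_neighbours[OF finW False, of "-1" 1] Z by (auto simp: W_def)
      have bd: "-1 \<le> p" "q \<le> 1" using pq(5)[of "-1"] pq(5)[of 1] Z \<open>-1 < t\<close> \<open>t < 1\<close> pq(3,4)
        by (auto simp: W_def)
      have nof: "poly f s \<noteq> 0" if "p < s" "s < q" for s
        using pq(5)[of s] that bd by (force simp: W_def Rt_def)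
      have nog: "poly g (k s) \<noteq> 0" if "p < s" "s < q" for s
        using pq(5)[of s] rootg[of s] that bd by force
      have nog': "poly g y \<noteq> 0" if "k p < y" "y < k q" for y
      proof -
        obtain s where "y = k s" using k(2) by (metis surjD)
        then show ?thesis using nog[of s] that kle(2) by simp
      qed
      \<comment> \<open>Rolle would put a critical point, hence a point of \<open>Z\<close>, inside
        a gap with roots at both ends. The sign inside the gap is then read off at an end where
        \<open>f\<close> is nonzero.\<close>
      have "poly f p \<noteq> 0 \<or> poly f q \<noteq> 0"
      proof (rule ccontr)
        assume "\<not> ?thesis"
        then obtain z where "p < z" "z < q" "poly (pderiv f) z = 0"
          using poly_rolle[of p q f] pq(3,4) by auto
        then show False using critf[of z] pq(5)[of z] bd by (force simp: W_def)
      qed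
      then consider (p) "poly f p \<noteq> 0" | (q) "poly f q \<noteq> 0" by blast
      then show ?thesis
      proof cases
        case p
        then have "poly g (k p) \<noteq> 0" using onW[OF pq(1)] by (metis sgn_zero_iff)
        have "sgn (poly f p) = sgn (poly f t)"
          using p nof pq(3,4) by (intro poly_same_sign) (force simp: order_le_less)
        moreover have "sgn (poly g (k p)) = sgn (poly g (k t))"
          using \<open>poly g (k p) \<noteq> 0\<close> nog' pq(3,4) kle(2)[of p t] kle(2)[of t q]
          by (intro poly_same_sign) (force simp: order_le_less)
        ultimately show ?thesis using onW[OF pq(1)] by simp
      next
        case q
        then have "poly g (k q) \<noteq> 0" using onW[OF pq(2)] by (metis sgn_zero_iff)
        have "sgn (poly f t) = sgn (poly f q)"
          using q nof pq(3,4) by (intro poly_same_sign) (force simp: order_le_less)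
        moreover have "sgn (poly g (k t)) = sgn (poly g (k q))"
          using \<open>poly g (k q) \<noteq> 0\<close> nog' pq(3,4) kle(2)[of p t] kle(2)[of t q]
          by (intro poly_same_sign) (force simp: order_le_less)
        ultimately show ?thesis using onW[OF pq(2)] by simp
      qed
    qed (use onW in blast)
  qed
  then show ?thesis using k(1,2) kZ by blast
qed

section \<open>Univariate polynomials with parameters\<close>

text \<open>The coefficient functions are kept abstract because elimination only adds and multiplies
  them. The instance in view is the ring of polynomial functions in a given set of
  variables.\<close>

locale function_ring =
  fixes R :: "('x \<Rightarrow> real) set"
  assumes const_mem: "(\<lambda>_. c) \<in> R"
    and add_mem: "\<lbrakk>r \<in> R; s \<in> R\<rbrakk> \<Longrightarrow> (\<lambda>x. r x + s x) \<in> R"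
    and mult_mem: "\<lbrakk>r \<in> R; s \<in> R\<rbrakk> \<Longrightarrow> (\<lambda>x. r x * s x) \<in> R"
begin

lemma uminus_mem: "r \<in> R \<Longrightarrow> (\<lambda>x. - r x) \<in> R"
  using mult_mem[OF const_mem[of "-1"]] by simp

lemma diff_mem: "\<lbrakk>r \<in> R; s \<in> R\<rbrakk> \<Longrightarrow> (\<lambda>x. r x - s x) \<in> R"
  using add_mem[OF _ uminus_mem] by simp

lemma sum_mem: "(\<And>i. i \<in> A \<Longrightarrow> r i \<in> R) \<Longrightarrow> (\<lambda>x. \<Sum>i\<in>A. r i x) \<in> R"
  by (induction A rule: infinite_finite_induct) (auto intro: const_mem add_mem)

text \<open>\<open>D\<close> is a formal degree: at particular parameters the coefficient of index
  \<open>D\<close> may vanish.\<close>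

definition param_polys :: "nat \<Rightarrow> ('x \<Rightarrow> real poly) set" where
  "param_polys D = {P. (\<forall>x. degree (P x) \<le> D) \<and> (\<forall>i. (\<lambda>x. coeff (P x) i) \<in> R)}"

lemma param_polysI:
  assumes "\<And>x i. i > D \<Longrightarrow> coeff (P x) i = 0" "\<And>i. (\<lambda>x. coeff (P x) i) \<in> R"
  shows "P \<in> param_polys D"
  using assms by (auto simp: param_polys_def intro: degree_le)

lemma param_polys_coeff: "P \<in> param_polys D \<Longrightarrow> (\<lambda>x. coeff (P x) i) \<in> R"
  by (simp add: param_polys_def)

lemma param_polys_coeff_zero: "\<lbrakk>P \<in> param_polys D; i > D\<rbrakk> \<Longrightarrow> coeff (P x) i = 0"
  by (auto simp: param_polys_def intro: coeff_eq_0 le_less_trans)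

lemma param_polys_mono: "\<lbrakk>P \<in> param_polys D; D \<le> E\<rbrakk> \<Longrightarrow> P \<in> param_polys E"
  by (auto simp: param_polys_def intro: order_trans)

lemma param_polys_poly_mem:
  assumes "P \<in> param_polys D"
  shows "(\<lambda>x. poly (P x) c) \<in> R"
proof -
  have "poly (P x) c = (\<Sum>i\<le>D. coeff (P x) i * c ^ i)" for x
  proof -
    have "(\<Sum>i\<le>degree (P x). coeff (P x) i * c ^ i) = (\<Sum>i\<le>D. coeff (P x) i * c ^ i)"
      using assms by (intro sum.mono_neutral_left) (auto simp: param_polys_def coeff_eq_0)
    then show ?thesis by (simp add: poly_altdef)
  qed
  moreover have "(\<lambda>x. \<Sum>i\<le>D. coeff (P x) i * c ^ i) \<in> R"
    by (intro sum_mem mult_mem const_mem param_polys_coeff[OF assms])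
  ultimately show ?thesis by simp
qed

lemma param_polys_pderiv:
  assumes "P \<in> param_polys (Suc D)"
  shows "(\<lambda>x. pderiv (P x)) \<in> param_polys D"
  using param_polys_coeff_zero[OF assms] param_polys_coeff[OF assms]
  by (intro param_polysI) (auto simp: coeff_pderiv intro: mult_mem const_mem)

text \<open>At parameters where the coefficient of index \<open>D\<close> vanishes this is the same
  polynomial, now with a smaller formal degree.\<close>

definition drop_lead :: "nat \<Rightarrow> ('x \<Rightarrow> real poly) \<Rightarrow> 'x \<Rightarrow> real poly" where
  "drop_lead D P = (\<lambda>x. P x - monom (coeff (P x) D) D)"

lemma param_polys_drop_lead:
  assumes "P \<in> param_polys (Suc D)"
  shows "drop_lead (Suc D) P \<in> param_polys D"
proof (rule param_polysI)
  show "coeff (drop_lead (Suc D) P x) i = 0" if "i > D" for x i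
    using that param_polys_coeff_zero[OF assms, of i x] by (cases "i = Suc D") (auto simp: drop_lead_def)
  show "(\<lambda>x. coeff (drop_lead (Suc D) P x) i) \<in> R" for i
    using param_polys_coeff[OF assms]
    by (cases "i = Suc D") (auto simp: drop_lead_def const_mem)
qed

text \<open>One step of pseudo-division, so that coefficients are never divided.\<close>

definition pseudo_step :: "nat \<Rightarrow> ('x \<Rightarrow> real poly) \<Rightarrow> ('x \<Rightarrow> real poly) \<times> nat \<Rightarrow> 'x \<Rightarrow> real poly" where
  "pseudo_step D P = (\<lambda>(Q, e) x. smult (coeff (Q x) e) (P x)
      - smult (coeff (P x) D) (monom 1 (D - e) * poly_cutoff (Suc e) (Q x)))"

text \<open>Here \<open>e\<close> is a guess at the degree of \<open>Q x\<close>. Cutting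
  \<open>Q\<close> off above \<open>e\<close> makes the two coefficients of index
  \<open>Suc D\<close> cancel at every parameter, whether or not the guess is right.\<close>

lemma param_polys_pseudo_step:
  assumes P: "P \<in> param_polys (Suc D)" and Q: "Q \<in> param_polys (Suc D)" and e: "e \<le> Suc D"
  shows "pseudo_step (Suc D) P (Q, e) \<in> param_polys D"
proof (rule param_polysI)
  show "coeff (pseudo_step (Suc D) P (Q, e) x) i = 0" if "i > D" for x i
  proof (cases "i = Suc D")
    case True
    then show ?thesis using e by (simp add: pseudo_step_def coeff_monom_mult coeff_poly_cutoff mult.commute[of "coeff (Q x) e"])
  next
    case False
    then have "i - (Suc D - e) > e" using that e by linarith
    then show ?thesis using False that param_polys_coeff_zero[OF P, of i x]
      by (simp add: pseudo_step_def coeff_monom_mult coeff_poly_cutoff)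
  qed
  show "(\<lambda>x. coeff (pseudo_step (Suc D) P (Q, e) x) i) \<in> R" for i
  proof -
    have "(\<lambda>x. coeff (monom 1 (Suc D - e) * poly_cutoff (Suc e) (Q x)) i) \<in> R"
      using param_polys_coeff[OF Q]
      by (cases "i < Suc D - e"; cases "i - (Suc D - e) < Suc e")
        (simp_all add: coeff_monom_mult coeff_poly_cutoff const_mem)
    then show ?thesis using param_polys_coeff[OF P] param_polys_coeff[OF Q]
      by (auto simp: pseudo_step_def intro!: diff_mem mult_mem)
  qed
qed

text \<open>With the right guess the cut-off changes nothing, so at a root of \<open>Q x\<close> the
  step multiplies \<open>poly (P x) t\<close> by the leading coefficient of \<open>Q x\<close>.
  Multiplying by the sign of that coefficient once more undoes this.\<close>

lemma sgn_at_root_pseudo_step: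
  assumes "Q x \<noteq> 0" "poly (Q x) t = 0"
  shows "sgn (poly (P x) t) =
    sgn (coeff (Q x) (degree (Q x))) * sgn (poly (pseudo_step D P (Q, degree (Q x)) x) t)"
proof -
  have "poly_cutoff (Suc (degree (Q x))) (Q x) = Q x"
    by (rule poly_eqI) (auto simp: coeff_poly_cutoff coeff_eq_0)
  then have "poly (pseudo_step D P (Q, degree (Q x)) x) t = coeff (Q x) (degree (Q x)) * poly (P x) t"
    using assms by (simp add: pseudo_step_def)
  then show ?thesis using assms(1) by (simp add: sgn_mult sgn_mult_self_eq flip: mult.assoc)
qed

text \<open>An increasing bijection of the line that fixes \<open>-1\<close> and \<open>1\<close>
  restricts to one of \<open>[-1, 1]\<close>, so the sign conditions realised there at
  \<open>x\<close> and at \<open>y\<close> are the same and occur in the same order.\<close>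

definition sign_iso :: "('x \<Rightarrow> real poly) set \<Rightarrow> 'x \<Rightarrow> 'x \<Rightarrow> bool" where
  "sign_iso F x y \<longleftrightarrow> (\<exists>h. strict_mono h \<and> surj h \<and> h (-1) = -1 \<and> h 1 = 1 \<and>
     (\<forall>P\<in>F. \<forall>t\<in>{-1..1}. sgn (poly (P x) t) = sgn (poly (P y) (h t))))"

lemma sign_iso_mono: "\<lbrakk>sign_iso F x y; G \<subseteq> F\<rbrakk> \<Longrightarrow> sign_iso G x y"
  unfolding sign_iso_def by blast

definition same_signs :: "('x \<Rightarrow> real) set \<Rightarrow> 'x \<Rightarrow> 'x \<Rightarrow> bool" where
  "same_signs C x y \<longleftrightarrow> (\<forall>c\<in>C. sgn (c x) = sgn (c y))"

lemma same_signs_Un [simp]: "same_signs (C \<union> D) x y \<longleftrightarrow> same_signs C x y \<and> same_signs D x y"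
  by (auto simp: same_signs_def)

lemma same_signs_mono: "\<lbrakk>same_signs C x y; D \<subseteq> C\<rbrakk> \<Longrightarrow> same_signs D x y"
  by (auto simp: same_signs_def)

lemma same_signs_degree:
  assumes "same_signs ((\<lambda>i x. coeff (P x) i) ` {..D}) x y" "P \<in> param_polys D"
  shows "degree (P x) = degree (P y)" "P x = 0 \<longleftrightarrow> P y = 0"
proof -
  have eq: "coeff (P x) i = 0 \<longleftrightarrow> coeff (P y) i = 0" for i
  proof (cases "i \<le> D")
    case True
    then have "sgn (coeff (P x) i) = sgn (coeff (P y) i)" using assms(1) by (auto simp: same_signs_def)
    then show ?thesis by (metis sgn_zero_iff)
  qed (use param_polys_coeff_zero[OF assms(2)] in auto)
  then show "P x = 0 \<longleftrightarrow> P y = 0" by (simp add: poly_eq_iff)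
  show "degree (P x) = degree (P y)"
    by (rule antisym; rule degree_le) (use eq coeff_eq_0 in blast)+
qed

text \<open>At a root of some \<open>g \<in> A\<close> the sign of \<open>f\<close> is that of a pseudo-remainder, and between
  consecutive such roots \<open>f\<close> is strictly monotone because its derivative belongs to \<open>A\<close>.\<close>

lemma sign_iso_insert:
  assumes f: "f \<in> param_polys (Suc D)" and A: "finite A" "A \<subseteq> param_polys (Suc D)"
    and f': "(\<lambda>x. pderiv (f x)) \<in> A"
    and lead: "coeff (f x) (Suc D) \<noteq> 0" "coeff (f y) (Suc D) \<noteq> 0"
    and ends: "sgn (poly (f x) (-1)) = sgn (poly (f y) (-1))" "sgn (poly (f x) 1) = sgn (poly (f y) 1)"
    and coeffs: "\<And>g. g \<in> A \<Longrightarrow> same_signs ((\<lambda>i x. coeff (g x) i) ` {..Suc D}) x y"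
    and iso: "sign_iso (A \<union> pseudo_step (Suc D) f ` (A \<times> {..Suc D})) x y"
  shows "sign_iso (insert f A) x y"
proof -
  obtain h where h: "strict_mono h" "surj h" "h (-1) = -1" "h 1 = 1"
    and hs: "\<And>g t. g \<in> A \<union> pseudo_step (Suc D) f ` (A \<times> {..Suc D}) \<Longrightarrow> t \<in> {-1..1} \<Longrightarrow>
        sgn (poly (g x) t) = sgn (poly (g y) (h t))"
    using iso unfolding sign_iso_def by blast
  have hA: "sgn (poly (g x) t) = sgn (poly (g y) (h t))" if "g \<in> A" "t \<in> {-1..1}" for g t
    using hs that by blast
  have hle: "h s \<le> h t \<longleftrightarrow> s \<le> t" "h s < h t \<longleftrightarrow> s < t" for s t
    using h(1) by (simp_all add: strict_mono_less strict_mono_less_eq)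
  have nzA: "g x = 0 \<longleftrightarrow> g y = 0" "degree (g x) = degree (g y)" if "g \<in> A" for g
    using same_signs_degree[OF coeffs[OF that]] that A(2) by blast+
  \<comment> \<open>The endpoints and the roots of those members of \<open>A\<close> that do not
    vanish identically at \<open>x\<close>; the critical points of \<open>f x\<close> are among
    them.\<close>
  define Z where "Z = {-1, 1} \<union> (\<Union>g\<in>{g \<in> A. g x \<noteq> 0}. {t \<in> {-1..1}. poly (g x) t = 0})"
  have finZ: "finite Z" unfolding Z_def using A(1)
    by (intro finite_UnI finite_UN_I) (auto intro: finite_subset[OF _ poly_roots_finite])
  have Zsub: "Z \<subseteq> {-1..1}" and ZI: "-1 \<in> Z" "1 \<in> Z" by (auto simp: Z_def)
  have pd: "pderiv (f z) \<noteq> 0" if "coeff (f z) (Suc D) \<noteq> 0" for z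
  proof
    assume "pderiv (f z) = 0"
    then have "coeff (pderiv (f z)) D = 0" by simp
    then show False using that by (simp add: coeff_pderiv)
  qed
  have root_y: "u \<in> h ` Z" if "g \<in> A" "g y \<noteq> 0" "u \<in> {-1..1}" "poly (g y) u = 0" for g u
  proof -
    obtain t where t: "u = h t" using h(2) by (metis surjD)
    then have "t \<in> {-1..1}" using that(3) hle(1)[of "-1" t] hle(1)[of t 1] h by auto
    moreover from this have "poly (g x) t = 0" using hA[OF that(1), of t] that(4) t by (simp add: sgn_zero_iff)
    ultimately show ?thesis using that nzA(1)[OF that(1)] t by (auto simp: Z_def)
  qed
  have "\<exists>k. strict_mono k \<and> surj k \<and> (\<forall>z\<in>Z. k z = h z) \<and>
             (\<forall>t\<in>{-1..1}. sgn (poly (f x) t) = sgn (poly (f y) (k t)))"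
  proof (rule sign_iso_adjust[OF finZ Zsub ZI h])
    show "t \<in> Z" if "t \<in> {-1..1}" "poly (pderiv (f x)) t = 0" for t
      using that f' pd[OF lead(1)] by (auto simp: Z_def)
    show "t \<in> h ` Z" if "t \<in> {-1..1}" "poly (pderiv (f y)) t = 0" for t
      using root_y[OF f'] that pd[OF lead(2)] by simp
    show "f x \<noteq> 0" using lead by auto
    fix z assume "z \<in> Z"
    then consider "z = -1 \<or> z = 1" | g where "g \<in> A" "g x \<noteq> 0" "z \<in> {-1..1}" "poly (g x) z = 0"
      unfolding Z_def by blast
    then show "sgn (poly (f x) z) = sgn (poly (f y) (h z))"
    proof cases
      case 1 then show ?thesis using ends h by auto
    next
      case 2
      \<comment> \<open>Both specialisations of \<open>g\<close> have the same degree, so one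
        pseudo-step serves at both parameters.\<close>
      define e where "e = degree (g x)"
      have e: "e = degree (g y)" "e \<le> Suc D"
        using nzA(2)[OF 2(1)] 2(1) A(2) by (auto simp: e_def param_polys_def)
      have "poly (g y) (h z) = 0" using hA[OF 2(1,3)] 2(4) by (simp add: sgn_zero_iff)
      then have "sgn (poly (f y) (h z)) =
          sgn (coeff (g y) e) * sgn (poly (pseudo_step (Suc D) f (g, e) y) (h z))"
        using sgn_at_root_pseudo_step[of g y] nzA(1)[OF 2(1)] 2(2) e(1) by blast
      moreover have "sgn (poly (f x) z) =
          sgn (coeff (g x) e) * sgn (poly (pseudo_step (Suc D) f (g, e) x) z)"
        using sgn_at_root_pseudo_step[of g x] 2 unfolding e_def by blast
      moreover have "sgn (coeff (g x) e) = sgn (coeff (g y) e)"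
        using coeffs[OF 2(1)] e(2) by (auto simp: same_signs_def)
      moreover have "sgn (poly (pseudo_step (Suc D) f (g, e) x) z) =
          sgn (poly (pseudo_step (Suc D) f (g, e) y) (h z))"
        using 2 e(2) by (intro hs) auto
      ultimately show ?thesis by simp
    qed
  qed
  then obtain k where k: "strict_mono k" "surj k" "\<And>z. z \<in> Z \<Longrightarrow> k z = h z"
    and kf: "\<And>t. t \<in> {-1..1} \<Longrightarrow> sgn (poly (f x) t) = sgn (poly (f y) (k t))" by blast
  have kle: "k s \<le> k t \<longleftrightarrow> s \<le> t" "k s < k t \<longleftrightarrow> s < t" for s t
    using k(1) by (simp_all add: strict_mono_less strict_mono_less_eq)
  have ke: "k (-1) = -1" "k 1 = 1" using k(3) ZI h by auto
  \<comment> \<open>Bending \<open>h\<close> into \<open>k\<close> does not spoil the signs of the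
    members of \<open>A\<close>: both maps are increasing and agree on \<open>Z\<close>, so for
    \<open>t\<close> off \<open>Z\<close> no root of a nonzero \<open>g y\<close> lies between
    \<open>h t\<close> and \<open>k t\<close>.\<close>
  have "sgn (poly (g x) t) = sgn (poly (g y) (k t))" if g: "g \<in> A" and t: "t \<in> {-1..1}" for g t
  proof (cases "t \<in> Z \<or> g x = 0")
    case True
    then show ?thesis using hA[OF g t] k(3) nzA(1)[OF g] by auto
  next
    case False
    have inI: "h t \<in> {-1..1}" "k t \<in> {-1..1}"
      using t hle(1)[of "-1" t] hle(1)[of t 1] h kle(1)[of "-1" t] kle(1)[of t 1] ke by auto
    have "sgn (poly (g y) (h t)) = sgn (poly (g y) (k t))"
    proof (rule poly_same_sign)
      fix u assume u: "min (h t) (k t) \<le> u" "u \<le> max (h t) (k t)"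
      show "poly (g y) u \<noteq> 0"
      proof
        assume "poly (g y) u = 0"
        moreover have "u \<in> {-1..1}" using u inI by auto
        ultimately obtain z where z: "z \<in> Z" "u = h z" using root_y[OF g] False nzA(1)[OF g] by blast
        have "z \<noteq> t" using z(1) False by auto
        then show False
          using u hle[of z t] hle[of t z] kle[of z t] kle[of t z] k(3)[OF z(1)] z(2)
          by (auto simp: min_def max_def split: if_splits)
      qed
    qed
    then show ?thesis using hA[OF g t] by simp
  qed
  then show ?thesis using k(1,2) ke kf unfolding sign_iso_def by blast
qed

text \<open>Induction on the formal degree and, inside it, on the set \<open>H\<close> of members
  that may attain it. A member \<open>f\<close> of \<open>H\<close> is removed in one of two ways.
  If its leading coefficient vanishes, \<open>drop_lead\<close> replaces it; otherwise its signs
  follow from those of its derivative, of its pseudo-steps and of the other members. All newcomers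
  have smaller formal degree and join \<open>F\<close>, which is why \<open>F\<close> varies in the
  inner induction.\<close>

theorem sign_iso_if_same_signs:
  assumes "finite F" "F \<subseteq> param_polys D"
  shows "\<exists>C. finite C \<and> C \<subseteq> R \<and> (\<forall>x y. same_signs C x y \<longrightarrow> sign_iso F x y)"
  using assms
proof (induction D arbitrary: F)
  case 0
  define C where "C = (\<lambda>P x. coeff (P x) 0) ` F"
  have "sign_iso F x y" if "same_signs C x y" for x y
  proof -
    have "sgn (poly (P x) t) = sgn (poly (P y) t)" if "P \<in> F" for P t
    proof -
      have "degree (P z) = 0" for z using that 0 by (auto simp: param_polys_def)
      then have "poly (P z) t = coeff (P z) 0" for z 
        by (metis coeff_pCons_0 degree_eq_zeroE mult_zero_right add.right_neutral poly_0 poly_pCons)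
      then show ?thesis using \<open>same_signs C x y\<close> that by (auto simp: same_signs_def C_def)
    qed
    then show ?thesis unfolding sign_iso_def
      by (intro exI[of _ id]) (auto simp: strict_mono_def)
  qed
  then show ?case using 0 by (intro exI[of _ C]) (auto simp: C_def param_polys_coeff)
next
  case (Suc D)
  have "\<exists>C. finite C \<and> C \<subseteq> R \<and> (\<forall>x y. same_signs C x y \<longrightarrow> sign_iso (F \<union> H) x y)"
    if "finite H" "H \<subseteq> param_polys (Suc D)" "finite F" "F \<subseteq> param_polys D" for F H
    using that
  proof (induction H arbitrary: F rule: finite_induct)
    case empty
    then show ?case using Suc.IH by simp
  next
    case (insert f H)
    have f: "f \<in> param_polys (Suc D)" using insert.prems by auto
    define A where "A = F \<union> H \<union> {\<lambda>x. pderiv (f x)}"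
    define S where "S = pseudo_step (Suc D) f ` (A \<times> {..Suc D})"
    have A: "finite A" "A \<subseteq> param_polys (Suc D)"
      using insert.prems insert.hyps param_polys_mono[of _ D "Suc D"] param_polys_pderiv[OF f]
      by (auto simp: A_def)
    have S: "finite S" "S \<subseteq> param_polys D"
      using A param_polys_pseudo_step[OF f] by (auto simp: S_def)
    obtain C1 where C1: "finite C1" "C1 \<subseteq> R"
      "\<And>x y. same_signs C1 x y \<Longrightarrow> sign_iso (insert (drop_lead (Suc D) f) F \<union> H) x y"
      using insert.IH[of "insert (drop_lead (Suc D) f) F"] insert.prems param_polys_drop_lead[OF f]
      by auto
    obtain C2 where C2: "finite C2" "C2 \<subseteq> R"
      "\<And>x y. same_signs C2 x y \<Longrightarrow> sign_iso (insert (\<lambda>x. pderiv (f x)) (F \<union> S) \<union> H) x y"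
      using insert.IH[of "insert (\<lambda>x. pderiv (f x)) (F \<union> S)"] insert.prems param_polys_pderiv[OF f] S
      by auto
    \<comment> \<open>\<open>C1\<close> and \<open>C2\<close> belong to the two cases for the
      leading coefficient of \<open>f\<close>. \<open>C3\<close> fixes that case, the actual degrees
      and the signs of the leading coefficients, and \<open>C4\<close> the signs at the endpoints.
      The union is taken because the set must not depend on the parameters.\<close>
    define C3 where "C3 = (\<Union>g\<in>insert f A. (\<lambda>i x. coeff (g x) i) ` {..Suc D})"
    define C4 where "C4 = {\<lambda>x. poly (f x) (-1), \<lambda>x. poly (f x) 1}"
    have "sign_iso (F \<union> insert f H) x y" if "same_signs (C1 \<union> C2 \<union> C3 \<union> C4) x y" for x y
    proof -
      have ss: "same_signs C1 x y" "same_signs C2 x y" "same_signs C3 x y" "same_signs C4 x y"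
        using that by auto
      have cf: "same_signs ((\<lambda>i x. coeff (g x) i) ` {..Suc D}) x y" if "g \<in> insert f A" for g
        using ss(3) unfolding C3_def by (rule same_signs_mono) (rule UN_upper[OF that])
      have lead: "coeff (f x) (Suc D) = 0 \<longleftrightarrow> coeff (f y) (Suc D) = 0"
      proof -
        have "sgn (coeff (f x) (Suc D)) = sgn (coeff (f y) (Suc D))"
          using cf[of f] unfolding same_signs_def by auto
        then show ?thesis by (metis sgn_zero_iff)
      qed
      show ?thesis
      proof (cases "coeff (f x) (Suc D) = 0")
        case True
        then have "drop_lead (Suc D) f x = f x" "drop_lead (Suc D) f y = f y"
          using lead by (auto simp: drop_lead_def)
        then show ?thesis using C1(3)[OF ss(1)] unfolding sign_iso_def by auto
      next
        case False
        have "sign_iso (insert f A) x y"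
        proof (rule sign_iso_insert[OF f A])
          show "sign_iso (A \<union> pseudo_step (Suc D) f ` (A \<times> {..Suc D})) x y"
            using C2(3)[OF ss(2)] by (rule sign_iso_mono) (auto simp: A_def S_def)
        qed (use False lead ss(4) cf in \<open>auto simp: A_def same_signs_def C4_def\<close>)
        then show ?thesis by (rule sign_iso_mono) (auto simp: A_def)
      qed
    qed
    moreover have "finite (C1 \<union> C2 \<union> C3 \<union> C4)" using C1 C2 A by (auto simp: C3_def C4_def)
    moreover have "C1 \<union> C2 \<union> C3 \<union> C4 \<subseteq> R"
      using C1 C2 A f param_polys_coeff param_polys_poly_mem[OF f] by (auto simp: C3_def C4_def)
    ultimately show ?case by (intro exI[of _ "C1 \<union> C2 \<union> C3 \<union> C4"] conjI allI impI)
  qed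
  from this[of F "{}"] Suc.prems show ?case by simp
qed

text \<open>Semi-algebraicity as an invariance. Since \<open>same_signs\<close> is symmetric, the
  implication amounts to an equivalence.\<close>

definition sign_determined :: "'x set \<Rightarrow> bool" where
  "sign_determined S \<longleftrightarrow> (\<exists>C. finite C \<and> C \<subseteq> R \<and> (\<forall>x y. same_signs C x y \<longrightarrow> x \<in> S \<longrightarrow> y \<in> S))"

end

section \<open>Semi-algebraic sets from sign conditions\<close>

text \<open>With functions in place of formal polynomials, the ring operations are introduction
  rules and a variable can be split off by rule induction. \<open>polyfun_mpoly\<close> returns to
  formal polynomials.\<close>

inductive_set polyfun :: "'v set \<Rightarrow> (('v \<Rightarrow> real) \<Rightarrow> real) set" for V :: "'v set" where
  const: "(\<lambda>_. c) \<in> polyfun V"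
| var: "v \<in> V \<Longrightarrow> (\<lambda>a. a v) \<in> polyfun V"
| add: "\<lbrakk>f \<in> polyfun V; g \<in> polyfun V\<rbrakk> \<Longrightarrow> (\<lambda>a. f a + g a) \<in> polyfun V"
| mult: "\<lbrakk>f \<in> polyfun V; g \<in> polyfun V\<rbrakk> \<Longrightarrow> (\<lambda>a. f a * g a) \<in> polyfun V"

interpretation pf: function_ring "polyfun V" for V
  by unfold_locales (auto intro: polyfun.intros)

lemma polyfun_power: "f \<in> polyfun V \<Longrightarrow> (\<lambda>a. f a ^ k) \<in> polyfun V"
  by (induction k) (auto intro: polyfun.intros)

lemma polyfun_prod: "(\<And>i. i \<in> A \<Longrightarrow> f i \<in> polyfun V) \<Longrightarrow> (\<lambda>a. \<Prod>i\<in>A. f i a) \<in> polyfun V"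
  by (induction A rule: infinite_finite_induct) (auto intro: polyfun.intros)

text \<open>Brings a polynomial function into the form on which elimination of \<open>v\<close>
  operates: the coefficients involve the other variables only.\<close>

lemma polyfun_as_param_poly:
  fixes V :: "'v set"
  assumes "f \<in> polyfun V"
  shows "\<exists>D P. P \<in> pf.param_polys (V - {v}) D \<and> (\<forall>x t. f (x(v := t)) = poly (P x) t)"
  using assms
proof induction
  case (const c)
  have "(\<lambda>_::'v \<Rightarrow> real. [:c:]) \<in> pf.param_polys (V - {v}) 0"
    by (rule pf.param_polysI) (auto simp: coeff_pCons split: nat.split intro: polyfun.const)
  then show ?case by force
next
  case (var u)
  show ?case
  proof (cases "u = v")
    case True
    have "(\<lambda>_::'v \<Rightarrow> real. [:0, 1:]) \<in> pf.param_polys (V - {v}) 1"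
      by (rule pf.param_polysI) (auto simp: coeff_pCons split: nat.split intro: polyfun.const)
    then show ?thesis using True by force
  next
    case False
    have "(\<lambda>x. coeff [:x u:] i) \<in> polyfun (V - {v})" for i
      using var False by (cases i) (auto simp: coeff_pCons intro: polyfun.intros)
    then have "(\<lambda>x. [:x u:]) \<in> pf.param_polys (V - {v}) 0"
      by (intro pf.param_polysI) (auto simp: coeff_pCons split: nat.split)
    then show ?thesis using False by force
  qed
next
  case (add f g)
  then obtain D P E Q where
    "P \<in> pf.param_polys (V - {v}) D" "\<And>x t. f (x(v := t)) = poly (P x) t"
    "Q \<in> pf.param_polys (V - {v}) E" "\<And>x t. g (x(v := t)) = poly (Q x) t" by blast
  moreover from this have "(\<lambda>x. P x + Q x) \<in> pf.param_polys (V - {v}) (max D E)"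
    by (intro pf.param_polysI)
      (auto simp: pf.param_polys_coeff_zero intro!: polyfun.add pf.param_polys_coeff)
  ultimately show ?case by (intro exI[of _ "max D E"] exI[of _ "\<lambda>x. P x + Q x"]) (simp del: fun_upd_apply)
next
  case (mult f g)
  then obtain D P E Q where
    "P \<in> pf.param_polys (V - {v}) D" "\<And>x t. f (x(v := t)) = poly (P x) t"
    "Q \<in> pf.param_polys (V - {v}) E" "\<And>x t. g (x(v := t)) = poly (Q x) t" by blast
  moreover have "(\<lambda>x. P x * Q x) \<in> pf.param_polys (V - {v}) (D + E)"
  proof -
    have "degree (P x * Q x) \<le> D + E" for x
    proof -
      have "degree (P x) + degree (Q x) \<le> D + E"
        using calculation by (intro add_mono) (auto simp: pf.param_polys_def)
      then show ?thesis using degree_mult_le[of "P x" "Q x"] by linarith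
    qed
    then show ?thesis using calculation
      by (auto simp: pf.param_polys_def coeff_mult intro!: pf.sum_mem polyfun.mult)
  qed
  ultimately show ?case by (intro exI[of _ "D + E"] exI[of _ "\<lambda>x. P x * Q x"]) (simp del: fun_upd_apply)
qed

text \<open>Every \<open>u\<close> in \<open>[-1, 1]\<close> is the image of some \<open>t\<close>
  in \<open>[-1, 1]\<close> under the sign-preserving bijection, so membership passes from
  \<open>x(v := t)\<close> to \<open>y(v := u)\<close>.\<close>

lemma sign_determined_forall:
  assumes "pf.sign_determined V S"
  shows "pf.sign_determined (V - {v}) {x. \<forall>t\<in>{-1..1}. x(v := t) \<in> S}"
proof -
  obtain C where C: "finite C" "C \<subseteq> polyfun V"
    "\<And>x y. pf.same_signs C x y \<Longrightarrow> x \<in> S \<Longrightarrow> y \<in> S"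
    using assms unfolding pf.sign_determined_def by blast
  have "\<forall>c\<in>C. \<exists>D P. P \<in> pf.param_polys (V - {v}) D \<and> (\<forall>x t. c (x(v := t)) = poly (P x) t)"
    using polyfun_as_param_poly[of _ V v] C(2) by (metis subsetD)
  then obtain D P where P: "\<And>c. c \<in> C \<Longrightarrow> P c \<in> pf.param_polys (V - {v}) (D c)"
    "\<And>c x t. c \<in> C \<Longrightarrow> c (x(v := t)) = poly (P c x) t"
    by metis
  have "P ` C \<subseteq> pf.param_polys (V - {v}) (Max (D ` C))"
    using C(1) by (auto intro!: pf.param_polys_mono[OF P(1)] Max_ge)
  then obtain B where B: "finite B" "B \<subseteq> polyfun (V - {v})"
    "\<And>x y. pf.same_signs B x y \<Longrightarrow> pf.sign_iso (P ` C) x y"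
    using pf.sign_iso_if_same_signs[of "P ` C" "V - {v}" "Max (D ` C)"] C(1) by blast
  have "y(v := u) \<in> S" if xy: "pf.same_signs B x y" and x: "\<forall>t\<in>{-1..1}. x(v := t) \<in> S" and u: "u \<in> {-1..1}" for x y u
  proof -
    obtain h where h: "strict_mono h" "surj h" "h (-1) = -1" "h 1 = 1"
      "\<And>c t. c \<in> C \<Longrightarrow> t \<in> {-1..1} \<Longrightarrow> sgn (poly (P c x) t) = sgn (poly (P c y) (h t))"
      using B(3)[OF xy] unfolding pf.sign_iso_def by blast
    obtain t where t: "u = h t" using h(2) by (metis surjD)
    then have "t \<in> {-1..1}"
      using u strict_mono_less_eq[OF h(1), of "-1" t] strict_mono_less_eq[OF h(1), of t 1] h by auto
    moreover from this have "pf.same_signs C (x(v := t)) (y(v := u))"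
      using h(5) P(2) t by (auto simp: pf.same_signs_def)
    ultimately show ?thesis using C(3) x by blast
  qed
  then show ?thesis using B(1,2) unfolding pf.sign_determined_def by blast
qed

lemma sign_determined_forall_finite:
  assumes "pf.sign_determined V S" "finite Y"
  shows "pf.sign_determined (V - Y)
    {x. \<forall>\<tau>. (\<forall>v\<in>Y. \<tau> v \<in> {-1..1}) \<longrightarrow> (\<lambda>v. if v \<in> Y then \<tau> v else x v) \<in> S}"
  using assms(2)
proof (induction Y rule: finite_induct)
  case empty
  then show ?case using assms(1) by simp
next
  case (insert w Y)
  define T where "T Y = {x. \<forall>\<tau>. (\<forall>v\<in>Y. \<tau> v \<in> {-1..1}) \<longrightarrow> (\<lambda>v. if v \<in> Y then \<tau> v else x v) \<in> S}" for Y
  have "{x. \<forall>t\<in>{-1..1}. x(w := t) \<in> T Y} = T (insert w Y)"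
  proof (intro equalityI subsetI)
    fix x assume x: "x \<in> {x. \<forall>t\<in>{-1..1}. x(w := t) \<in> T Y}"
    show "x \<in> T (insert w Y)" unfolding T_def
    proof (intro CollectI allI impI)
      fix \<tau> :: "'a \<Rightarrow> real" assume \<tau>: "\<forall>v\<in>insert w Y. \<tau> v \<in> {-1..1}"
      then have "x(w := \<tau> w) \<in> T Y" using x by auto
      then have "(\<lambda>v. if v \<in> Y then \<tau> v else (x(w := \<tau> w)) v) \<in> S" using \<tau> by (auto simp: T_def)
      also have "(\<lambda>v. if v \<in> Y then \<tau> v else (x(w := \<tau> w)) v) = (\<lambda>v. if v \<in> insert w Y then \<tau> v else x v)"
        by auto
      finally show "(\<lambda>v. if v \<in> insert w Y then \<tau> v else x v) \<in> S" .
    qed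
  next
    fix x assume x: "x \<in> T (insert w Y)"
    show "x \<in> {x. \<forall>t\<in>{-1..1}. x(w := t) \<in> T Y}"
    proof (intro CollectI ballI)
      fix t :: real assume t: "t \<in> {-1..1}"
      show "x(w := t) \<in> T Y" unfolding T_def
      proof (intro CollectI allI impI)
        fix \<tau> :: "'a \<Rightarrow> real" assume \<tau>: "\<forall>v\<in>Y. \<tau> v \<in> {-1..1}"
        then have "(\<lambda>v. if v \<in> insert w Y then (\<tau>(w := t)) v else x v) \<in> S"
          using x t unfolding T_def by (auto simp del: fun_upd_apply simp: fun_upd_def)
        also have "(\<lambda>v. if v \<in> insert w Y then (\<tau>(w := t)) v else x v) = (\<lambda>v. if v \<in> Y then \<tau> v else (x(w := t)) v)"
          using insert.hyps by auto
        finally show "(\<lambda>v. if v \<in> Y then \<tau> v else (x(w := t)) v) \<in> S" .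
      qed
    qed
  qed
  moreover have "V - Y - {w} = V - insert w Y" by auto
  ultimately show ?case using sign_determined_forall[OF insert.IH, of w] unfolding T_def by simp
qed

text \<open>Evaluation and \<^const>\<open>tensor_map\<close> are both instances of this linear functional.\<close>

definition lin_ext :: "('m \<Rightarrow> real) \<Rightarrow> ('m \<Rightarrow>\<^sub>0 real) \<Rightarrow> real" where
  "lin_ext \<phi> q = (\<Sum>m\<in>Poly_Mapping.keys q. Poly_Mapping.lookup q m * \<phi> m)"

lemma lin_ext_eq_sum:
  "finite K \<Longrightarrow> Poly_Mapping.keys q \<subseteq> K \<Longrightarrow> lin_ext \<phi> q = (\<Sum>m\<in>K. Poly_Mapping.lookup q m * \<phi> m)"
  unfolding lin_ext_def by (intro sum.mono_neutral_left) (auto simp: in_keys_iff)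

lemma lin_ext_add: "lin_ext \<phi> (p + q) = lin_ext \<phi> p + lin_ext \<phi> q"
proof -
  define K where "K = Poly_Mapping.keys p \<union> Poly_Mapping.keys q"
  have "finite K" "Poly_Mapping.keys p \<subseteq> K" "Poly_Mapping.keys q \<subseteq> K" "Poly_Mapping.keys (p + q) \<subseteq> K"
    using Poly_Mapping.keys_add[of p q] by (auto simp: K_def)
  then show ?thesis by (simp add: lin_ext_eq_sum lookup_add algebra_simps sum.distrib)
qed

lemma lin_ext_zero [simp]: "lin_ext \<phi> 0 = 0"
  by (simp add: lin_ext_def)

lemma lin_ext_single [simp]: "lin_ext \<phi> (Poly_Mapping.single m c) = c * \<phi> m"
  by (simp add: lin_ext_def)

lemma lin_ext_sum: "lin_ext \<phi> (\<Sum>i\<in>A. q i) = (\<Sum>i\<in>A. lin_ext \<phi> (q i))"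
  by (induction A rule: infinite_finite_induct) (auto simp: lin_ext_add)

lemma poly_mapping_sum_single:
  fixes q :: "'m \<Rightarrow>\<^sub>0 real"
  assumes "finite K" "Poly_Mapping.keys q \<subseteq> K"
  shows "q = (\<Sum>m\<in>K. Poly_Mapping.single m (Poly_Mapping.lookup q m))"
proof (rule poly_mapping_eqI)
  fix k
  have "Poly_Mapping.lookup (\<Sum>m\<in>K. Poly_Mapping.single m (Poly_Mapping.lookup q m)) k =
     (\<Sum>m\<in>K. if m = k then Poly_Mapping.lookup q m else 0)"
    by (simp add: lookup_sum lookup_single when_def)
  then show "Poly_Mapping.lookup q k = Poly_Mapping.lookup (\<Sum>m\<in>K. Poly_Mapping.single m (Poly_Mapping.lookup q m)) k"
    using assms by (auto simp: in_keys_iff)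
qed

section \<open>Evaluation of polynomials in several variables\<close>

definition mono_eval :: "('v \<Rightarrow> real) \<Rightarrow> ('v \<Rightarrow>\<^sub>0 nat) \<Rightarrow> real" where
  "mono_eval a m = (\<Prod>i\<in>Poly_Mapping.keys m. a i ^ Poly_Mapping.lookup m i)"

lemma mono_eval_superset:
  assumes "finite K" "Poly_Mapping.keys m \<subseteq> K"
  shows "mono_eval a m = (\<Prod>i\<in>K. a i ^ Poly_Mapping.lookup m i)"
  unfolding mono_eval_def using assms by (intro prod.mono_neutral_left) (auto simp: in_keys_iff)

lemma mono_eval_add: "mono_eval a (m + m') = mono_eval a m * mono_eval a m'"
proof -
  define K where "K = Poly_Mapping.keys m \<union> Poly_Mapping.keys m'"
  have "finite K" "Poly_Mapping.keys m \<subseteq> K" "Poly_Mapping.keys m' \<subseteq> K" "Poly_Mapping.keys (m + m') \<subseteq> K"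
    using Poly_Mapping.keys_add[of m m'] by (auto simp: K_def)
  then show ?thesis by (simp add: mono_eval_superset[of K] lookup_add power_add prod.distrib)
qed

lemma mpoly_eval_lin_ext: "mpoly_eval p a = lin_ext (mono_eval a) p"
  by (simp add: mpoly_eval_def lin_ext_def mono_eval_def)

lemma mpoly_eval_mult: "mpoly_eval (p * q) a = mpoly_eval p a * mpoly_eval q a"
proof -
  let ?l = Poly_Mapping.lookup and ?K = Poly_Mapping.keys
  have "p * q = (\<Sum>m\<in>?K p. Poly_Mapping.single m (?l p m)) * (\<Sum>m\<in>?K q. Poly_Mapping.single m (?l q m))"
    using poly_mapping_sum_single[of "?K p" p] poly_mapping_sum_single[of "?K q" q] by simp
  also have "\<dots> = (\<Sum>m\<in>?K p. \<Sum>m'\<in>?K q. Poly_Mapping.single (m + m') (?l p m * ?l q m'))"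
    by (simp add: sum_product mult_single)
  finally have "lin_ext (mono_eval a) (p * q) =
      (\<Sum>m\<in>?K p. \<Sum>m'\<in>?K q. (?l p m * mono_eval a m) * (?l q m' * mono_eval a m'))"
    by (simp add: lin_ext_sum mono_eval_add mult_ac)
  then show ?thesis by (simp add: mpoly_eval_lin_ext lin_ext_def sum_product)
qed

lemma mpoly_vars_mult: "mpoly_vars (p * q) \<subseteq> mpoly_vars p \<union> mpoly_vars q"
proof
  fix v assume "v \<in> mpoly_vars (p * q)"
  then obtain m where "m \<in> Poly_Mapping.keys (p * q)" "v \<in> Poly_Mapping.keys m"
    by (auto simp: mpoly_vars_def)
  then obtain b c where "b \<in> Poly_Mapping.keys p" "c \<in> Poly_Mapping.keys q" "m = b + c"
    using keys_mult[of p q] by blast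
  then show "v \<in> mpoly_vars p \<union> mpoly_vars q"
    using \<open>v \<in> Poly_Mapping.keys m\<close> Poly_Mapping.keys_add[of b c] by (auto simp: mpoly_vars_def)
qed

lemma mpoly_vars_add: "mpoly_vars (p + q) \<subseteq> mpoly_vars p \<union> mpoly_vars q"
  using Poly_Mapping.keys_add[of p q] by (auto simp: mpoly_vars_def)

lemma polyfun_mpoly:
  assumes "f \<in> polyfun V"
  shows "\<exists>q. mpoly_vars q \<subseteq> V \<and> (\<forall>a. mpoly_eval q a = f a)"
  using assms
proof induction
  case (const c)
  show ?case
    by (rule exI[of _ "Poly_Mapping.single 0 c"]) (auto simp: mpoly_vars_def mpoly_eval_lin_ext mono_eval_def)
next
  case (var v)
  then show ?case
    by (intro exI[of _ "Poly_Mapping.single (Poly_Mapping.single v 1) 1"])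
      (auto simp: mpoly_vars_def mpoly_eval_lin_ext mono_eval_def)
next
  case (add f g)
  then obtain p q where "mpoly_vars p \<subseteq> V" "\<And>a. mpoly_eval p a = f a" "mpoly_vars q \<subseteq> V" "\<And>a. mpoly_eval q a = g a"
    by blast
  then show ?case using mpoly_vars_add[of p q]
    by (intro exI[of _ "p + q"]) (auto simp: mpoly_eval_lin_ext lin_ext_add)
next
  case (mult f g)
  then obtain p q where "mpoly_vars p \<subseteq> V" "\<And>a. mpoly_eval p a = f a" "mpoly_vars q \<subseteq> V" "\<And>a. mpoly_eval q a = g a"
    by blast
  then show ?case using mpoly_vars_mult[of p q]
    by (intro exI[of _ "p * q"]) (auto simp: mpoly_eval_mult)
qed

text \<open>Each point of \<open>S\<close> contributes the piece of all points that share its sign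
  vector on \<open>C\<close>; by invariance this piece stays inside \<open>S\<close>. There are
  finitely many pieces, as each is given by subsets of a finite set of polynomials.\<close>

lemma semialgebraic_on_if_sign_determined:
  assumes "pf.sign_determined V S"
  shows "semialgebraic_on V {a \<in> S. \<forall>v. v \<notin> V \<longrightarrow> a v = 0}"
proof -
  obtain C where C: "finite C" "C \<subseteq> polyfun V"
    "\<And>x y. pf.same_signs C x y \<Longrightarrow> x \<in> S \<Longrightarrow> y \<in> S"
    using assms unfolding pf.sign_determined_def by blast
  obtain q where q: "\<And>f. f \<in> polyfun V \<Longrightarrow> mpoly_vars (q f) \<subseteq> V" "\<And>f a. f \<in> polyfun V \<Longrightarrow> mpoly_eval (q f) a = f a"
    using polyfun_mpoly by metis
  \<comment> \<open>Pieces only offer the condition \<open>> 0\<close>, so a negative sign of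
    \<open>c\<close> is recorded by a polynomial representing \<open>- c\<close>.\<close>
  define q' where "q' c = q (\<lambda>x. - c x)" for c
  have q': "mpoly_vars (q' c) \<subseteq> V" "mpoly_eval (q' c) a = - c a" if "c \<in> C" for c a
    using q[OF pf.uminus_mem, of c] that C(2) by (auto simp: q'_def)
  define E G where "E a = q ` {c \<in> C. c a = 0}" and "G a = q ` {c \<in> C. c a > 0} \<union> q' ` {c \<in> C. c a < 0}" for a
  define \<P> where "\<P> = (\<lambda>a. (E a, G a)) ` S"
  have "\<P> \<subseteq> Pow (q ` C) \<times> Pow (q ` C \<union> q' ` C)" by (auto simp: \<P>_def E_def G_def)
  then have "finite \<P>" by (rule finite_subset) (use C(1) in auto)
  moreover have "finite E' \<and> finite G' \<and> (\<forall>p\<in>E' \<union> G'. mpoly_vars p \<subseteq> V)" if "(E', G') \<in> \<P>" for E' G'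
  proof -
    obtain a where "E' = E a" "G' = G a" using \<open>(E', G') \<in> \<P>\<close> by (auto simp: \<P>_def)
    moreover have "\<forall>c\<in>C. mpoly_vars (q c) \<subseteq> V \<and> mpoly_vars (q' c) \<subseteq> V"
      using C(2) q(1) q'(1) by blast
    ultimately show ?thesis using C(1) by (auto simp: E_def G_def subset_iff)
  qed
  moreover have piece: "((\<forall>p\<in>E a. mpoly_eval p b = 0) \<and> (\<forall>p\<in>G a. mpoly_eval p b > 0)) \<longleftrightarrow> pf.same_signs C a b" for a b
  proof -
    have vals: "mpoly_eval (q c) b = c b" "mpoly_eval (q' c) b = - c b" if "c \<in> C" for c
      using q(2) q'(2) C(2) that by auto
    have "((\<forall>p\<in>E a. mpoly_eval p b = 0) \<and> (\<forall>p\<in>G a. mpoly_eval p b > 0)) \<longleftrightarrow>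
        (\<forall>c\<in>C. (c a = 0 \<longrightarrow> c b = 0) \<and> (c a > 0 \<longrightarrow> c b > 0) \<and> (c a < 0 \<longrightarrow> c b < 0))"
      unfolding E_def G_def ball_Un by (simp add: vals cong: conj_cong) (use vals in fastforce)
    also have "\<dots> \<longleftrightarrow> pf.same_signs C a b"
      unfolding pf.same_signs_def
      by (intro ball_cong refl) (auto simp: sgn_real_def split: if_splits)
    finally show ?thesis .
  qed
  have "{a \<in> S. \<forall>v. v \<notin> V \<longrightarrow> a v = 0} = (\<Union>(E, G)\<in>\<P>. {a. (\<forall>v. v \<notin> V \<longrightarrow> a v = 0) \<and>
                                (\<forall>q\<in>E. mpoly_eval q a = 0) \<and> (\<forall>q\<in>G. mpoly_eval q a > 0)})" (is "?L = ?R")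
  proof (intro equalityI subsetI)
    fix b assume "b \<in> ?L"
    then show "b \<in> ?R" using piece[of b b] by (auto simp: \<P>_def pf.same_signs_def)
  next
    fix b assume "b \<in> ?R"
    then obtain a where "a \<in> S" "\<forall>v. v \<notin> V \<longrightarrow> b v = 0" "(\<forall>p\<in>E a. mpoly_eval p b = 0) \<and> (\<forall>p\<in>G a. mpoly_eval p b > 0)"
      by (auto simp: \<P>_def)
    then show "b \<in> ?L" using C(3) piece[of a b] by auto
  qed
  ultimately show ?thesis unfolding semialgebraic_on_def by (intro exI[of _ \<P>]) auto
qed

section \<open>Laplace transforms of powers of the logarithm\<close>

lemma abs_exp_minus_one_le: "\<bar>exp x - 1\<bar> \<le> \<bar>x\<bar> * exp \<bar>x\<bar>" for x :: real
proof (cases "x \<ge> 0")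
  case True
  have "(1 - x) * exp x \<le> exp (- x) * exp x"
    using exp_ge_add_one_self[of "- x"] by (intro mult_right_mono) auto
  then show ?thesis using True by (simp add: algebra_simps exp_minus)
next
  case False
  have "1 - exp x \<le> - x" using exp_ge_add_one_self[of x] by linarith
  also have "- x \<le> - x * exp (- x)" using False by (simp add: mult_le_cancel_left1)
  finally show ?thesis using False by simp
qed

text \<open>Covers the derivatives of Gamma (\<open>w = ln\<close>) as well as those of Laplace transforms (\<open>w = - id\<close>).\<close>

lemma has_real_derivative_exp_integral:
  fixes h w :: "'a \<Rightarrow> real"
  assumes meas [measurable]: "h \<in> borel_measurable M" "w \<in> borel_measurable M"
    and int: "\<And>z. a < z \<Longrightarrow> integrable M (\<lambda>t. h t * exp (z * w t))" and z: "a < z"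
  shows "integrable M (\<lambda>t. h t * w t * exp (z * w t))"
    and "((\<lambda>z. \<integral>t. h t * exp (z * w t) \<partial>M) has_real_derivative
           (\<integral>t. h t * w t * exp (z * w t) \<partial>M)) (at z)"
proof -
  define \<delta> where "\<delta> = (z - a) / 4"
  have \<delta>: "\<delta> > 0" "a < z - 2 * \<delta>" unfolding \<delta>_def using z by (auto simp: field_simps)
  \<comment> \<open>The dominating function. Of the shift by \<open>2 * \<delta>\<close>, one
    \<open>\<delta>\<close> pays for the difference quotient and the other for the factor
    \<open>\<bar>w t\<bar>\<close>; both directions occur because \<open>w t\<close> may have either
    sign.\<close>
  define B where "B t = (\<bar>h t * exp ((z + 2 * \<delta>) * w t)\<bar> + \<bar>h t * exp ((z - 2 * \<delta>) * w t)\<bar>) / \<delta>" for t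
  have intB: "integrable M B" unfolding B_def using \<delta> z 
    by (intro Bochner_Integration.integrable_divide Bochner_Integration.integrable_add integrable_abs int) auto
  have key: "\<bar>w t\<bar> * exp (\<delta> * \<bar>w t\<bar>) \<le> (exp (2 * \<delta> * w t) + exp (- 2 * \<delta> * w t)) / \<delta>" for t
  proof -
    have "\<delta> * \<bar>w t\<bar> \<le> exp (\<delta> * \<bar>w t\<bar>)"
      using exp_ge_add_one_self[of "\<delta> * \<bar>w t\<bar>"] by linarith
    then have "\<delta> * \<bar>w t\<bar> * exp (\<delta> * \<bar>w t\<bar>) \<le> exp (\<delta> * \<bar>w t\<bar>) * exp (\<delta> * \<bar>w t\<bar>)"
      by (intro mult_right_mono) auto
    also have "\<dots> = exp (2 * \<delta> * \<bar>w t\<bar>)" by (simp flip: exp_add)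
    also have "\<dots> \<le> exp (2 * \<delta> * w t) + exp (- 2 * \<delta> * w t)"
      by (cases "w t \<ge> 0") auto
    finally show ?thesis using \<delta> by (simp add: field_simps)
  qed
  have bound: "\<bar>h t\<bar> * exp (z * w t) * (\<bar>w t\<bar> * exp (\<delta> * \<bar>w t\<bar>)) \<le> B t" for t
  proof -
    have "\<bar>h t\<bar> * exp (z * w t) * (\<bar>w t\<bar> * exp (\<delta> * \<bar>w t\<bar>)) \<le>
        \<bar>h t\<bar> * exp (z * w t) * ((exp (2 * \<delta> * w t) + exp (- 2 * \<delta> * w t)) / \<delta>)"
      by (intro mult_left_mono key) auto
    also have "\<dots> = B t"
    proof -
      have e: "exp ((z + 2 * \<delta>) * w t) = exp (z * w t) * exp (2 * \<delta> * w t)"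
        "exp ((z - 2 * \<delta>) * w t) = exp (z * w t) * exp (- 2 * \<delta> * w t)"
        by (simp_all add: algebra_simps flip: exp_add)
      show ?thesis unfolding B_def e by (simp add: abs_mult field_simps)
    qed
    finally show ?thesis .
  qed
  show "integrable M (\<lambda>t. h t * w t * exp (z * w t))"
  proof (rule Bochner_Integration.integrable_bound[OF intB])
    show "AE t in M. norm (h t * w t * exp (z * w t)) \<le> norm (B t)"
    proof (rule AE_I2)
      fix t
      have "1 \<le> exp (\<delta> * \<bar>w t\<bar>)" using \<delta> by simp
      then have "\<bar>h t\<bar> * exp (z * w t) * (\<bar>w t\<bar> * 1) \<le> \<bar>h t\<bar> * exp (z * w t) * (\<bar>w t\<bar> * exp (\<delta> * \<bar>w t\<bar>))"
        by (intro mult_left_mono) auto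
      then show "norm (h t * w t * exp (z * w t)) \<le> norm (B t)"
        using bound[of t] abs_ge_self[of "B t"] by (simp add: abs_mult mult_ac)
    qed
  qed measurable
  define F where "F z = (\<integral>t. h t * exp (z * w t) \<partial>M)" for z
  \<comment> \<open>Restricting to an open interval around \<open>0\<close> keeps every test
    sequence within the range of the domination and does not change the limit.\<close>
  have "((\<lambda>s. (F (z + s) - F z) / s) \<longlongrightarrow> (\<integral>t. h t * w t * exp (z * w t) \<partial>M)) (at 0 within {-\<delta><..<\<delta>})"
    unfolding tendsto_at_iff_sequentially
  proof (intro allI impI)
    fix X :: "nat \<Rightarrow> real"
    assume "\<forall>i. X i \<in> {-\<delta><..<\<delta>} - {0}" and X0: "X \<longlonglongrightarrow> 0"
    then have X: "X i \<noteq> 0" "\<bar>X i\<bar> \<le> \<delta>" for i by (auto simp: abs_le_iff less_imp_le order_less_imp_le minus_less_iff)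
    define g where "g i t = h t * ((exp ((z + X i) * w t) - exp (z * w t)) / X i)" for i t
    have "(\<lambda>i. \<integral>t. g i t \<partial>M) \<longlonglongrightarrow> (\<integral>t. h t * w t * exp (z * w t) \<partial>M)"
    proof (rule integral_dominated_convergence[where w = B])
      show "AE t in M. (\<lambda>i. g i t) \<longlonglongrightarrow> h t * w t * exp (z * w t)"
      proof (rule AE_I2)
        fix t
        have "((\<lambda>z. exp (z * w t)) has_real_derivative w t * exp (z * w t)) (at z)"
          by (auto intro!: derivative_eq_intros)
        then have "((\<lambda>s. (exp ((z + s) * w t) - exp (z * w t)) / s) \<longlongrightarrow> w t * exp (z * w t)) (at 0)"
          by (simp add: DERIV_def)
        then have "((\<lambda>s. (exp ((z + s) * w t) - exp (z * w t)) / s) \<circ> X) \<longlonglongrightarrow> w t * exp (z * w t)"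
          unfolding tendsto_at_iff_sequentially using X(1) X0 by auto
        then show "(\<lambda>i. g i t) \<longlonglongrightarrow> h t * w t * exp (z * w t)"
          unfolding g_def mult.assoc by (intro tendsto_mult_left) (simp add: comp_def)
      qed
      show "AE t in M. norm (g i t) \<le> B t" for i
      proof (rule AE_I2)
        fix t
        have "(exp ((z + X i) * w t) - exp (z * w t)) / X i = exp (z * w t) * ((exp (X i * w t) - 1) / X i)"
          by (simp add: algebra_simps exp_add)
        moreover have "\<bar>(exp (X i * w t) - 1) / X i\<bar> \<le> \<bar>w t\<bar> * exp (\<delta> * \<bar>w t\<bar>)"
        proof -
          have "\<bar>exp (X i * w t) - 1\<bar> \<le> \<bar>X i * w t\<bar> * exp \<bar>X i * w t\<bar>" by (rule abs_exp_minus_one_le)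
          also have "\<dots> \<le> \<bar>X i * w t\<bar> * exp (\<delta> * \<bar>w t\<bar>)"
            using X(2)[of i] by (intro mult_left_mono) (auto simp: abs_mult intro!: mult_right_mono)
          finally show ?thesis using X(1)[of i] by (simp add: abs_mult field_simps)
        qed
        then have "\<bar>h t\<bar> * exp (z * w t) * \<bar>(exp (X i * w t) - 1) / X i\<bar> \<le>
            \<bar>h t\<bar> * exp (z * w t) * (\<bar>w t\<bar> * exp (\<delta> * \<bar>w t\<bar>))"
          by (intro mult_left_mono) auto
        ultimately have "norm (g i t) \<le> \<bar>h t\<bar> * exp (z * w t) * (\<bar>w t\<bar> * exp (\<delta> * \<bar>w t\<bar>))"
          by (simp only: g_def real_norm_def abs_mult abs_exp_cancel mult.assoc)
        then show "norm (g i t) \<le> B t" using bound[of t] by linarith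
      qed
    qed (use intB in \<open>auto simp: g_def\<close>)
    moreover have "(\<integral>t. g i t \<partial>M) = (F (z + X i) - F z) / X i" for i
    proof -
      have "a < z + X i" using X(2)[of i] \<delta> by linarith
      then have "F (z + X i) - F z = (\<integral>t. h t * exp ((z + X i) * w t) - h t * exp (z * w t) \<partial>M)"
        unfolding F_def using int z by (intro Bochner_Integration.integral_diff[symmetric]) auto
      moreover have "(\<integral>t. g i t \<partial>M) = (\<integral>t. (h t * exp ((z + X i) * w t) - h t * exp (z * w t)) / X i \<partial>M)"
        by (intro Bochner_Integration.integral_cong) (auto simp: g_def right_diff_distrib)
      ultimately show ?thesis by simp
    qed
    ultimately show "((\<lambda>s. (F (z + s) - F z) / s) \<circ> X) \<longlonglongrightarrow> (\<integral>t. h t * w t * exp (z * w t) \<partial>M)"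
      by (simp add: comp_def)
  qed
  moreover have "at 0 within {-\<delta><..<\<delta>} = at (0::real)" using \<delta> by (intro at_within_open) auto
  ultimately show "((\<lambda>z. \<integral>t. h t * exp (z * w t) \<partial>M) has_real_derivative
           (\<integral>t. h t * w t * exp (z * w t) \<partial>M)) (at z)"
    unfolding DERIV_def F_def[symmetric] by simp
qed

section \<open>Integrals for the derivatives of Gamma and for \<open>phi_A\<close>\<close>

text \<open>Euler's integral with \<open>t powr (z - 1)\<close> written as
  \<open>exp (z * ln t) / t\<close>, the shape in which it can be differentiated under the integral
  sign.\<close>

lemma Gamma_has_bochner_integral:
  fixes z :: real
  assumes "z > 0"
  shows "has_bochner_integral lborel (\<lambda>t. indicat_real {0<..} t * exp (- t) / t * exp (z * ln t)) (Gamma z)"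
proof (rule has_bochner_integral_nn_integral)
  have "(\<integral>\<^sup>+t. ennreal (indicat_real {0<..} t * exp (- t) / t * exp (z * ln t)) \<partial>lborel) =
      (\<integral>\<^sup>+t. ennreal (indicator {0..} t * t powr (z - 1) / exp t) \<partial>lborel)"
  proof (intro nn_integral_cong arg_cong[where f = ennreal])
    fix t :: real
    show "indicat_real {0<..} t * exp (- t) / t * exp (z * ln t) = indicator {0..} t * t powr (z - 1) / exp t"
      by (cases "t > 0") (auto simp: indicator_def powr_def exp_minus field_simps exp_diff)
  qed
  then show "(\<integral>\<^sup>+t. ennreal (indicat_real {0<..} t * exp (- t) / t * exp (z * ln t)) \<partial>lborel) = ennreal (Gamma z)"
    using Gamma_conv_nn_integral_real[OF assms] by simp
qed (use assms in \<open>auto simp: indicator_def Gamma_real_nonneg less_imp_le Gamma_real_pos\<close>)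

text \<open>Each differentiation uses the previous formula on a neighbourhood, hence the induction
  over all \<open>z > 0\<close> at once.\<close>

lemma higher_deriv_Gamma:
  assumes "z > 0"
  shows "has_bochner_integral lborel (\<lambda>t. indicat_real {0<..} t * exp (- t) / t * ln t ^ l * exp (z * ln t))
           ((deriv ^^ l) Gamma z)"
  using assms
proof (induction l arbitrary: z)
  case 0
  then show ?case using Gamma_has_bochner_integral by simp
next
  case (Suc l)
  define h where "h t = indicat_real {0<..} t * exp (- t) / t * ln t ^ l" for t :: real
  have [measurable]: "h \<in> borel_measurable lborel" unfolding h_def by measurable
  have int: "integrable lborel (\<lambda>t. h t * exp (x * ln t))" "(\<integral>t. h t * exp (x * ln t) \<partial>lborel) = (deriv ^^ l) Gamma x"
    if "x > 0" for x
    using Suc.IH[OF that] by (auto simp: h_def has_bochner_integral_iff)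
  have "((\<lambda>z. \<integral>t. h t * exp (z * ln t) \<partial>lborel) has_real_derivative (\<integral>t. h t * ln t * exp (z * ln t) \<partial>lborel)) (at z)"
    using int(1) Suc.prems by (intro has_real_derivative_exp_integral(2)[where a = 0]) auto
  then have "((deriv ^^ l) Gamma has_real_derivative (\<integral>t. h t * ln t * exp (z * ln t) \<partial>lborel)) (at z)"
    by (rule has_field_derivative_transform_within_open[where S = "{0<..}"]) (use Suc.prems int(2) in auto)
  then have "(deriv ^^ Suc l) Gamma z = (\<integral>t. h t * ln t * exp (z * ln t) \<partial>lborel)"
    by (simp add: DERIV_imp_deriv)
  moreover have "integrable lborel (\<lambda>t. h t * ln t * exp (z * ln t))"
    using int(1) Suc.prems by (intro has_real_derivative_exp_integral(1)[where a = 0]) auto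
  ultimately show ?case by (simp add: has_bochner_integral_iff h_def mult_ac)
qed

definition log_laplace_kernel :: "nat \<Rightarrow> nat \<Rightarrow> real \<Rightarrow> real \<Rightarrow> real" where
  "log_laplace_kernel k l x u = indicat_real {0<..} u * u ^ k * ln u ^ l * exp (- (x * u))"

definition log_laplace :: "nat \<Rightarrow> nat \<Rightarrow> real \<Rightarrow> real" where
  "log_laplace k l x = (\<integral>u. log_laplace_kernel k l x u \<partial>lborel)"

lemma phi_A_monom:
  assumes "x > 0"
  shows "phi_A (monom 1 l) x =
    (\<Sum>m\<le>l. (-1) ^ m * real (l choose m) * gamma_deriv (l - m) * (ln x ^ m / x))"
proof -
  define S where "S k = (\<Sum>m\<le>k. (-1) ^ m * real (k choose m) * gamma_deriv (k - m) * (ln x ^ m / x))" for k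
  have "phi_A (monom 1 l) x = (\<Sum>k\<le>l. coeff (monom 1 l) k * S k)"
    using assms by (simp add: phi_A_def degree_monom_eq S_def)
  also have "\<dots> = (\<Sum>k\<le>l. if k = l then S k else 0)"
    by (intro sum.cong) auto
  finally show ?thesis by (simp add: S_def)
qed

lemma phi_A_monom_has_bochner_integral:
  assumes "x > 0"
  shows "has_bochner_integral lborel (log_laplace_kernel 0 l x) (phi_A (monom 1 l) x)"
proof -
  define G where "G j t = indicat_real {0<..} t * exp (- t) * ln t ^ j" for j and t :: real
  have G: "has_bochner_integral lborel (G j) (gamma_deriv j)" for j
  proof -
    have "(\<lambda>t. indicat_real {0<..} t * exp (- t) / t * ln t ^ j * exp (1 * ln t)) = G j"
      by (auto simp: G_def indicator_def)
    then show ?thesis using higher_deriv_Gamma[of 1 j] by (simp add: gamma_deriv_def)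
  qed
  have "has_bochner_integral lborel (\<lambda>u. G j (0 + x * u)) (gamma_deriv j /\<^sub>R \<bar>x\<bar>)" for j
    using G[of j] assms by (subst (asm) lborel_has_bochner_integral_real_affine_iff[of x _ _ 0]) auto
  then have "has_bochner_integral lborel
      (\<lambda>u. \<Sum>m\<le>l. of_nat (l choose m) * (- ln x) ^ m * G (l - m) (0 + x * u))
      (\<Sum>m\<le>l. of_nat (l choose m) * (- ln x) ^ m * (gamma_deriv (l - m) /\<^sub>R \<bar>x\<bar>))"
    by (intro has_bochner_integral_sum has_bochner_integral_mult_right) auto
  moreover have "(\<lambda>u. \<Sum>m\<le>l. of_nat (l choose m) * (- ln x) ^ m * G (l - m) (0 + x * u)) = log_laplace_kernel 0 l x"
  proof
    fix u
    show "(\<Sum>m\<le>l. of_nat (l choose m) * (- ln x) ^ m * G (l - m) (0 + x * u)) = log_laplace_kernel 0 l x u"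
    proof (cases "u > 0")
      case True
      \<comment> \<open>The binomial expansion of this sum is the origin of the alternating sum in
        \<open>phi_A\<close>.\<close>
      then have "ln u = - ln x + ln (x * u)" using assms by (simp add: ln_mult)
      then have "ln u ^ l = (\<Sum>m\<le>l. of_nat (l choose m) * (- ln x) ^ m * ln (x * u) ^ (l - m))"
        by (metis binomial_ring)
      then show ?thesis using True assms
        by (simp add: G_def log_laplace_kernel_def sum_distrib_left mult_ac)
    qed (use assms in \<open>auto simp: G_def log_laplace_kernel_def indicator_def zero_less_mult_iff\<close>)
  qed
  moreover have "(\<Sum>m\<le>l. of_nat (l choose m) * (- ln x) ^ m * (gamma_deriv (l - m) /\<^sub>R \<bar>x\<bar>)) = phi_A (monom 1 l) x"
  proof -
    have "phi_A (monom 1 l) x = (\<Sum>m\<le>l. (-1) ^ m * real (l choose m) * gamma_deriv (l - m) * (ln x ^ m / x))"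
      using assms by (rule phi_A_monom)
    also have "\<dots> = (\<Sum>m\<le>l. of_nat (l choose m) * (- ln x) ^ m * (gamma_deriv (l - m) /\<^sub>R \<bar>x\<bar>))"
      using assms by (intro sum.cong refl) (simp add: power_minus[of "ln x"] field_simps)
    finally show ?thesis by simp
  qed
  ultimately show ?thesis by simp
qed

lemma log_laplace_0: "x > 0 \<Longrightarrow> log_laplace 0 l x = phi_A (monom 1 l) x"
  using phi_A_monom_has_bochner_integral by (simp add: log_laplace_def has_bochner_integral_iff)

text \<open>Integrability of the kernel for \<open>Suc k\<close> is a by-product of differentiating
  the transform for \<open>k\<close>, so an induction on \<open>k\<close> that starts from the
  integral for \<open>phi_A\<close> gives both claims.\<close>

lemma
  assumes "x > 0"
  shows integrable_log_laplace_kernel: "integrable lborel (log_laplace_kernel k l x)"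
    and has_real_derivative_log_laplace:
      "(log_laplace k l has_real_derivative - log_laplace (Suc k) l x) (at x)"
proof -
  have *: "integrable lborel (log_laplace_kernel (Suc k) l x) \<and>
      (log_laplace k l has_real_derivative - log_laplace (Suc k) l x) (at x)"
    if int: "\<And>x. x > 0 \<Longrightarrow> integrable lborel (log_laplace_kernel k l x)" and "x > 0" for k x
  proof -
    define h where "h u = indicat_real {0<..} u * u ^ k * ln u ^ l" for u :: real
    have [measurable]: "h \<in> borel_measurable lborel" unfolding h_def by measurable
    have ker: "log_laplace_kernel k l z = (\<lambda>u. h u * exp (z * (- u)))" for z
      by (auto simp: log_laplace_kernel_def h_def)
    have ker': "log_laplace_kernel (Suc k) l z = (\<lambda>u. - (h u * (- u) * exp (z * (- u))))" for z
      by (auto simp: log_laplace_kernel_def h_def)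
    have "integrable lborel (\<lambda>u. h u * (- u) * exp (x * (- u)))"
      using int that(2) by (intro has_real_derivative_exp_integral(1)[where a = 0]) (auto simp: ker)
    moreover have "((\<lambda>z. \<integral>u. h u * exp (z * (- u)) \<partial>lborel) has_real_derivative
        (\<integral>u. h u * (- u) * exp (x * (- u)) \<partial>lborel)) (at x)"
      using int that(2) by (intro has_real_derivative_exp_integral(2)[where a = 0]) (auto simp: ker)
    ultimately show ?thesis
      unfolding log_laplace_def[abs_def] ker ker' Bochner_Integration.integral_minus
      by (auto simp only: minus_minus intro: Bochner_Integration.integrable_minus)
  qed
  have int: "\<And>x. x > 0 \<Longrightarrow> integrable lborel (log_laplace_kernel k l x)" for k
  proof (induction k)
    case 0
    then show ?case using phi_A_monom_has_bochner_integral by (auto simp: has_bochner_integral_iff)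
  next
    case (Suc k)
    then show ?case using * by blast
  qed
  show "integrable lborel (log_laplace_kernel k l x)" using int assms by blast
  show "(log_laplace k l has_real_derivative - log_laplace (Suc k) l x) (at x)" using * int assms by blast
qed

section \<open>Moments and concentration of gamma densities\<close>

text \<open>Differentiating \<open>1 / x\<close> repeatedly gives the normalising constants and the
  moments of the gamma densities.\<close>

lemma log_laplace_zero_right:
  assumes "x > 0"
  shows "log_laplace k 0 x = fact k / x ^ Suc k"
  using assms
proof (induction k arbitrary: x)
  case 0
  then show ?case by (simp add: log_laplace_0 phi_A_def gamma_deriv_def)
next
  case (Suc k)
  have "((\<lambda>x. fact k * inverse x ^ Suc k) has_real_derivative - (fact (Suc k) * inverse x ^ Suc (Suc k))) (at x)"
    using DERIV_cmult[OF DERIV_power[OF DERIV_inverse], of x "fact k" "Suc k"] Suc.prems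
    by (simp add: algebra_simps del: power_Suc) (simp add: algebra_simps)
  moreover have "((\<lambda>x. fact k * inverse x ^ Suc k) has_real_derivative - log_laplace (Suc k) 0 x) (at x)"
    by (rule has_field_derivative_transform_within_open[OF has_real_derivative_log_laplace, where S = "{0<..}"])
      (use Suc in \<open>auto simp: divide_inverse power_inverse\<close>)
  ultimately have "- (fact (Suc k) * inverse x ^ Suc (Suc k)) = - log_laplace (Suc k) 0 x"
    by (rule DERIV_unique)
  then show ?case by (simp add: divide_inverse power_inverse)
qed


text \<open>Near \<open>0\<close> continuity gives \<open>\<epsilon>\<close>; away from
  \<open>0\<close> the hyperbolic term is at least a positive multiple of
  \<open>exp \<bar>w\<bar>\<close> and outgrows every power. This majorant is chosen because for
  \<open>w = ln u - y\<close> it is a combination of \<open>u\<close>, \<open>1 / u\<close> and a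
  constant, whose integrals are explicit moments.\<close>

lemma power_diff_le_cosh:
  fixes y \<epsilon> :: real
  assumes "\<epsilon> > 0"
  obtains C where "C \<ge> 0" "\<And>w. \<bar>(y + w) ^ l - y ^ l\<bar> \<le> \<epsilon> + C * (exp w + exp (- w) - 2)"
proof -
  have "isCont (\<lambda>w. (y + w) ^ l - y ^ l) 0" by (intro continuous_intros)
  then obtain \<delta> where \<delta>: "\<delta> > 0" "\<And>w. \<bar>w\<bar> < \<delta> \<Longrightarrow> \<bar>(y + w) ^ l - y ^ l\<bar> < \<epsilon>"
    using assms unfolding continuous_at_eps_delta by (auto simp: dist_real_def)
  \<comment> \<open>\<open>c\<close> bounds \<open>(1 - exp (- \<bar>w\<bar>))\<^sup>2\<close> from
    below for \<open>\<bar>w\<bar> \<ge> \<delta>\<close>; \<open>K\<close> comes from using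
    \<open>x ^ l \<le> fact l * exp x\<close> for each of two powers.\<close>
  define c where "c = (1 - exp (- \<delta>))\<^sup>2"
  define K where "K = 2 * fact l * exp \<bar>y\<bar>"
  have c: "c > 0" using \<delta> by (simp add: c_def)
  have cosh: "exp w + exp (- w) - 2 = exp \<bar>w\<bar> * (1 - exp (- \<bar>w\<bar>))\<^sup>2" for w :: real
    by (cases "w \<ge> 0") (simp_all add: power2_eq_square algebra_simps flip: exp_add)
  have pow: "x ^ l \<le> fact l * exp x" if "x \<ge> 0" for x :: real
  proof -
    have "(\<Sum>i\<in>{l}. inverse (fact i) * x ^ i) \<le> exp x"
      unfolding exp_def using that summable_exp[of x]
      by (simp only: real_scaleR_def divide_inverse_commute) (intro sum_le_suminf; simp add: summable_exp)
    then show ?thesis by (simp add: field_simps)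
  qed
  have "\<bar>(y + w) ^ l - y ^ l\<bar> \<le> \<epsilon> + K / c * (exp w + exp (- w) - 2)" for w
  proof (cases "\<bar>w\<bar> < \<delta>")
    case True
    have "K / c * (exp w + exp (- w) - 2) \<ge> 0" using c by (simp add: cosh K_def)
    then show ?thesis using \<delta>(2)[OF True] by linarith
  next
    case False
    have "\<bar>(y + w) ^ l - y ^ l\<bar> \<le> \<bar>y + w\<bar> ^ l + \<bar>y\<bar> ^ l"
      by (metis abs_triangle_ineq4 power_abs)
    also have "\<dots> \<le> (\<bar>y\<bar> + \<bar>w\<bar>) ^ l + (\<bar>y\<bar> + \<bar>w\<bar>) ^ l"
      by (intro add_mono power_mono) auto
    also have "\<dots> \<le> 2 * (fact l * exp (\<bar>y\<bar> + \<bar>w\<bar>))" using pow[of "\<bar>y\<bar> + \<bar>w\<bar>"] by simp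
    also have "\<dots> = K / c * (exp \<bar>w\<bar> * c)" using c by (simp add: K_def exp_add)
    also have "\<dots> \<le> K / c * (exp \<bar>w\<bar> * (1 - exp (- \<bar>w\<bar>))\<^sup>2)"
      unfolding c_def using False \<delta>(1) by (intro mult_left_mono power_mono) (auto simp: K_def)
    finally show ?thesis using assms by (simp add: cosh)
  qed
  then show ?thesis using that[of "K / c"] c by (simp add: K_def)
qed

text \<open>The normalised kernels are gamma densities with mean tending to \<open>exp y\<close>; they concentrate,
  since the expectation of \<open>u / exp y + exp y / u - 2\<close> is \<open>1 / k\<close>.\<close>

lemma log_laplace_concentrates:
  fixes y :: real
  defines "x \<equiv> \<lambda>k. real k * exp (- y)"
  shows "(\<lambda>k. x k ^ Suc k / fact k * log_laplace k l (x k)) \<longlonglongrightarrow> y ^ l"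
proof (rule LIMSEQ_I)
  fix r :: real assume "r > 0"
  then obtain C where C: "C \<ge> 0" "\<And>w. \<bar>(y + w) ^ l - y ^ l\<bar> \<le> r / 2 + C * (exp w + exp (- w) - 2)"
    using power_diff_le_cosh[of "r / 2" y l] by auto
  have bound: "\<bar>x k ^ Suc k / fact k * log_laplace k l (x k) - y ^ l\<bar> \<le> r / 2 + C / k" if kpos: "k \<ge> 1" for k
  proof -
    \<comment> \<open>Division by \<open>u\<close> lowers the index of the kernel to
      \<open>j\<close>, which requires \<open>k \<ge> 1\<close>.\<close>
    obtain j where k: "k = Suc j" using kpos by (cases k) auto
    have x: "x k > 0" using that by (simp add: x_def)
    define a where "a = x k ^ Suc k / fact k"
    have a: "a > 0" using x by (simp add: a_def)
    have I: "has_bochner_integral lborel (log_laplace_kernel i m (x k)) (log_laplace i m (x k))" for i m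
      using integrable_log_laplace_kernel[OF x] by (simp add: has_bochner_integral_iff log_laplace_def)
    have mom: "a * log_laplace k 0 (x k) = 1" "a * log_laplace (Suc k) 0 (x k) = exp y * (1 + 1 / k)"
      "a * log_laplace j 0 (x k) = exp (- y)"
    proof -
      show "a * log_laplace k 0 (x k) = 1"
        using x by (simp add: a_def log_laplace_zero_right[OF x])
      have "a * log_laplace (Suc k) 0 (x k) = (real k + 1) / x k"
        using x by (simp add: a_def log_laplace_zero_right[OF x])
      also have "\<dots> = exp y * (1 + 1 / k)" using that by (simp add: x_def exp_minus field_simps)
      finally show "a * log_laplace (Suc k) 0 (x k) = exp y * (1 + 1 / k)" .
      have fk: "(fact k :: real) = real k * fact j" and xk: "x k ^ Suc k = x k * (x k ^ Suc j)"
        by (simp_all add: k)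
      have "a * log_laplace j 0 (x k) = x k / k"
        unfolding a_def log_laplace_zero_right[OF x] fk xk using x kpos by (simp add: field_simps del: power_Suc)
      then show "a * log_laplace j 0 (x k) = exp (- y)" using that by (simp add: x_def)
    qed
    define f where "f u = a * (log_laplace_kernel k l (x k) u - y ^ l * log_laplace_kernel k 0 (x k) u)" for u
    \<comment> \<open>The majorant of \<open>power_diff_le_cosh\<close> times the density:
      \<open>exp w = u * exp (- y)\<close> raises the index to \<open>Suc k\<close>, and
      \<open>exp (- w) = exp y / u\<close> lowers it to \<open>j\<close>.\<close>
    define g where "g u = a * ((r / 2 - 2 * C) * log_laplace_kernel k 0 (x k) u
        + (C * exp (- y)) * log_laplace_kernel (Suc k) 0 (x k) u
        + (C * exp y) * log_laplace_kernel j 0 (x k) u)" for u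
    have f: "has_bochner_integral lborel f (a * (log_laplace k l (x k) - y ^ l * log_laplace k 0 (x k)))"
      unfolding f_def by (intro has_bochner_integral_mult_right has_bochner_integral_diff I)
    have g: "has_bochner_integral lborel g (a * ((r / 2 - 2 * C) * log_laplace k 0 (x k)
        + (C * exp (- y)) * log_laplace (Suc k) 0 (x k) + (C * exp y) * log_laplace j 0 (x k)))"
      unfolding g_def by (intro has_bochner_integral_mult_right has_bochner_integral_add I)
    have fg: "\<bar>f u\<bar> \<le> g u" for u
    proof (cases "u > 0")
      case True
      define w where "w = ln u - y"
      define p where "p = a * (u ^ k * exp (- (x k * u)))"
      have p: "p \<ge> 0" using a True by (simp add: p_def)
      have u: "exp w = u * exp (- y)" "exp (- w) = exp y / u"
        using True by (simp_all add: w_def exp_diff exp_minus field_simps)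
      have "f u = p * ((y + w) ^ l - y ^ l)"
        using True by (simp add: f_def p_def log_laplace_kernel_def w_def algebra_simps)
      then have "\<bar>f u\<bar> = p * \<bar>(y + w) ^ l - y ^ l\<bar>" using p by (simp add: abs_mult)
      also have "\<dots> \<le> p * (r / 2 + C * (exp w + exp (- w) - 2))" by (intro mult_left_mono C p)
      also have "\<dots> = g u"
        unfolding u using True by (simp add: g_def p_def log_laplace_kernel_def k field_simps)
      finally show ?thesis .
    qed (simp add: f_def g_def log_laplace_kernel_def)
    have "\<bar>integral\<^sup>L lborel f\<bar> \<le> (\<integral>u. \<bar>f u\<bar> \<partial>lborel)" by (rule integral_abs_bound)
    also have "\<dots> \<le> integral\<^sup>L lborel g"
      using f g fg by (intro integral_mono integrable_abs) (auto simp: has_bochner_integral_iff)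
    finally have "\<bar>a * (log_laplace k l (x k) - y ^ l * log_laplace k 0 (x k))\<bar> \<le>
        a * ((r / 2 - 2 * C) * log_laplace k 0 (x k)
        + (C * exp (- y)) * log_laplace (Suc k) 0 (x k) + (C * exp y) * log_laplace j 0 (x k))"
      using f g by (simp add: has_bochner_integral_iff)
    also have "\<dots> = (r / 2 - 2 * C) * (a * log_laplace k 0 (x k))
        + (C * exp (- y)) * (a * log_laplace (Suc k) 0 (x k)) + (C * exp y) * (a * log_laplace j 0 (x k))"
      by (simp add: algebra_simps)
    also have "\<dots> = r / 2 + C / k"
      unfolding mom using that by (simp add: exp_minus field_simps)
    also have "a * (log_laplace k l (x k) - y ^ l * log_laplace k 0 (x k)) =
        a * log_laplace k l (x k) - y ^ l * (a * log_laplace k 0 (x k))" by (simp add: algebra_simps)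
    finally show ?thesis unfolding mom by (simp add: a_def)
  qed
  have "(\<lambda>k. C / real k) \<longlonglongrightarrow> 0" by (rule lim_const_over_n)
  then obtain N where N: "\<And>k. k \<ge> N \<Longrightarrow> \<bar>C / real k\<bar> < r / 2"
    using LIMSEQ_D[of "\<lambda>k. C / real k" 0 "r / 2"] \<open>r > 0\<close> by auto
  have "norm (x k ^ Suc k / fact k * log_laplace k l (x k) - y ^ l) < r" if "k \<ge> max 1 N" for k
  proof -
    have "k \<ge> 1" "k \<ge> N" using that by auto
    then show ?thesis using bound[of k] N[of k] abs_ge_self[of "C / real k"] unfolding real_norm_def by linarith
  qed
  then show "\<exists>N. \<forall>k\<ge>N. norm (x k ^ Suc k / fact k * log_laplace k l (x k) - y ^ l) < r" by blast
qed

section \<open>The tensor map\<close>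

lemma mono_eval_UNIV: "mono_eval a m = (\<Prod>i\<in>UNIV. a i ^ Poly_Mapping.lookup m i)"
  for a :: "'s::finite \<Rightarrow> real"
  by (rule mono_eval_superset) auto

lemma mono_degree_UNIV: "mono_degree m = (\<Sum>i\<in>UNIV. Poly_Mapping.lookup m i)"
  for m :: "'s::finite \<Rightarrow>\<^sub>0 nat"
  unfolding mono_degree_def by (intro sum.mono_neutral_left) (auto simp: in_keys_iff)

section \<open>Polynomials of bounded degree and their values\<close>

definition mpoly_scale :: "real \<Rightarrow> 'v mpoly \<Rightarrow> 'v mpoly" where
  "mpoly_scale c = Poly_Mapping.map ((*) c)"

lemma lookup_mpoly_scale [simp]: "Poly_Mapping.lookup (mpoly_scale c q) m = c * Poly_Mapping.lookup q m"
  by (simp add: mpoly_scale_def Poly_Mapping.map.rep_eq when_def)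

lemma keys_mpoly_scale: "Poly_Mapping.keys (mpoly_scale c q) \<subseteq> Poly_Mapping.keys q"
  by (auto simp: in_keys_iff)

lemma lin_ext_mpoly_scale: "lin_ext \<phi> (mpoly_scale c q) = c * lin_ext \<phi> q"
  unfolding lin_ext_eq_sum[OF finite_keys keys_mpoly_scale]
  by (simp add: lin_ext_def sum_distrib_left mult.assoc)

lemma mpolys_le_add: "\<lbrakk>p \<in> mpolys_le n; q \<in> mpolys_le n\<rbrakk> \<Longrightarrow> p + q \<in> mpolys_le n"
  using Poly_Mapping.keys_add[of p q] by (auto simp: mpolys_le_def)

lemma mpolys_le_scale: "p \<in> mpolys_le n \<Longrightarrow> mpoly_scale c p \<in> mpolys_le n"
  using keys_mpoly_scale[of c p] by (auto simp: mpolys_le_def)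

lemma mpolys_le_zero: "0 \<in> mpolys_le n"
  by (simp add: mpolys_le_def)

lemma mpolys_le_single: "mono_degree m \<le> n \<Longrightarrow> Poly_Mapping.single m c \<in> mpolys_le n"
  by (simp add: mpolys_le_def)

lemma mpolys_le_sum: "(\<And>i. i \<in> A \<Longrightarrow> q i \<in> mpolys_le n) \<Longrightarrow> (\<Sum>i\<in>A. q i) \<in> mpolys_le n"
  by (induction A rule: infinite_finite_induct) (auto simp: mpolys_le_zero mpolys_le_add)

lemma finite_mono_degree_le: "finite {m :: 's::finite \<Rightarrow>\<^sub>0 nat. mono_degree m \<le> n}"
proof (rule finite_imageD)
  have "Poly_Mapping.lookup ` {m :: 's \<Rightarrow>\<^sub>0 nat. mono_degree m \<le> n} \<subseteq> (\<Pi>\<^sub>E i\<in>UNIV. {..n})"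
  proof clarify
    fix m :: "'s \<Rightarrow>\<^sub>0 nat" assume m: "mono_degree m \<le> n"
    have "Poly_Mapping.lookup m i \<le> n" for i
    proof -
      have "Poly_Mapping.lookup m i \<le> mono_degree m"
        unfolding mono_degree_UNIV by (rule member_le_sum) auto
      then show ?thesis using m by simp
    qed
    then show "Poly_Mapping.lookup m \<in> (\<Pi>\<^sub>E i\<in>UNIV. {..n})" by (simp add: PiE_iff)
  qed
  then show "finite (Poly_Mapping.lookup ` {m :: 's \<Rightarrow>\<^sub>0 nat. mono_degree m \<le> n})"
    by (rule finite_subset) (auto intro: finite_PiE)
  show "inj_on Poly_Mapping.lookup {m :: 's \<Rightarrow>\<^sub>0 nat. mono_degree m \<le> n}"
    by (auto intro: inj_onI)
qed

text \<open>The coordinates outside \<open>S\<close> are forgotten, so that \<open>S\<close> can grow one coordinate at a time.\<close>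

lemma coeffs_zero_if_eval_zero:
  fixes c :: "'m \<Rightarrow> real" and e :: "'m \<Rightarrow> 's \<Rightarrow> nat"
  assumes "finite S" "finite A" "inj_on (\<lambda>m. restrict (e m) S) A"
    and "\<And>y. (\<Sum>m\<in>A. c m * (\<Prod>i\<in>S. y i ^ e m i)) = 0" and "m \<in> A"
  shows "c m = (0::real)"
  using assms
proof (induction S arbitrary: A m rule: finite_induct)
  case empty
  then have "A = {m}" by (auto simp: inj_on_def)
  then show ?case using empty.prems by simp
next
  case (insert j S)
  define A' where "A' = {m' \<in> A. e m' j = e m j}"
  have "(\<Sum>m'\<in>A'. c m' * (\<Prod>i\<in>S. y i ^ e m' i)) = 0" for y
  proof -
    \<comment> \<open>As a polynomial in coordinate \<open>j\<close> alone, with the others fixed,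
      the identity can be compared coefficientwise; the coefficient of index \<open>e m j\<close>
      collects exactly the terms from \<open>A'\<close>.\<close>
    define P where "P = (\<Sum>m'\<in>A. monom (c m' * (\<Prod>i\<in>S. y i ^ e m' i)) (e m' j))"
    have "poly P t = 0" for t
    proof -
      have "(\<Prod>i\<in>insert j S. (y(j := t)) i ^ e m' i) = t ^ e m' j * (\<Prod>i\<in>S. y i ^ e m' i)" for m'
      proof -
        have "(\<Prod>i\<in>S. (y(j := t)) i ^ e m' i) = (\<Prod>i\<in>S. y i ^ e m' i)"
          using insert.hyps by (intro prod.cong) auto
        then show ?thesis using insert.hyps by simp
      qed
      then show ?thesis using insert.prems(3)[of "y(j := t)"]
        by (simp add: P_def poly_sum poly_monom mult_ac)
    qed
    then have "coeff P (e m j) = 0" using poly_all_0_iff_0[of P] by simp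
    then show ?thesis using insert.prems(1)
      by (simp add: P_def coeff_sum A'_def sum.inter_filter)
  qed
  moreover have "inj_on (\<lambda>m. restrict (e m) S) A'"
  proof (rule inj_onI)
    fix a b assume ab: "a \<in> A'" "b \<in> A'" "restrict (e a) S = restrict (e b) S"
    have "restrict (e a) (insert j S) = restrict (e b) (insert j S)"
    proof
      fix i
      have "e a i = e b i" if "i \<in> S" using fun_cong[OF ab(3), of i] that by simp
      then show "restrict (e a) (insert j S) i = restrict (e b) (insert j S) i"
        using ab(1,2) by (simp add: A'_def restrict_def)
    qed
    then show "a = b" using ab(1,2) by (intro inj_onD[OF insert.prems(2)]) (auto simp: A'_def)
  qed
  moreover have "finite A'" "m \<in> A'" using insert.prems by (auto simp: A'_def)
  ultimately show ?case by (intro insert.IH)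
qed

lemma mpoly_eval_inj:
  fixes p q :: "'s::finite mpoly"
  assumes "\<And>y. mpoly_eval p y = mpoly_eval q y"
  shows "p = q"
proof (rule poly_mapping_eqI)
  fix k
  define K where "K = insert k (Poly_Mapping.keys p \<union> Poly_Mapping.keys q)"
  have K: "finite K" "Poly_Mapping.keys p \<subseteq> K" "Poly_Mapping.keys q \<subseteq> K" by (auto simp: K_def)
  have "Poly_Mapping.lookup p k - Poly_Mapping.lookup q k = 0"
  proof (rule coeffs_zero_if_eval_zero[where S = UNIV and A = K and e = Poly_Mapping.lookup])
    fix y :: "'s \<Rightarrow> real"
    show "(\<Sum>m\<in>K. (Poly_Mapping.lookup p m - Poly_Mapping.lookup q m) * (\<Prod>i\<in>UNIV. y i ^ Poly_Mapping.lookup m i)) = 0"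
      using assms[of y] K by (simp add: mpoly_eval_lin_ext lin_ext_eq_sum[of K] mono_eval_UNIV left_diff_distrib sum_subtractf)
  qed (use K in \<open>auto simp: K_def restrict_def poly_mapping.lookup_inject intro!: inj_onI\<close>)
  then show "Poly_Mapping.lookup p k = Poly_Mapping.lookup q k" by simp
qed

section \<open>Derivatives of the tensor map and complete monotonicity\<close>

text \<open>On the orthant this will be \<open>alt_deriv \<alpha> (tensor_map phi_A q)\<close>, the
  signs of the derivatives being absorbed.\<close>

definition tensor_log_laplace :: "('s::finite \<Rightarrow> nat) \<Rightarrow> 's mpoly \<Rightarrow> real ^ 's \<Rightarrow> real" where
  "tensor_log_laplace \<alpha> q x =
     lin_ext (\<lambda>m. \<Prod>j\<in>UNIV. log_laplace (\<alpha> j) (Poly_Mapping.lookup m j) (x $ j)) q"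

lemma tensor_map_lin_ext:
  "tensor_map \<phi> q x = lin_ext (\<lambda>m. \<Prod>j\<in>UNIV. \<phi> (monom 1 (Poly_Mapping.lookup m j)) (x $ j)) q"
  by (simp add: tensor_map_def lin_ext_def)

lemma tensor_map_phi_A:
  assumes "x \<in> orthant"
  shows "tensor_map phi_A q x = tensor_log_laplace (\<lambda>_. 0) q x"
  using assms by (simp add: tensor_map_lin_ext tensor_log_laplace_def log_laplace_0 orthant_def)

lemma tensor_map_phi_A_outside:
  assumes "x \<notin> orthant"
  shows "tensor_map phi_A q x = 0"
proof -
  obtain i where "\<not> x $ i > 0" using assms by (auto simp: orthant_def)
  then have "phi_A p (x $ i) = 0" for p by (simp add: phi_A_def)
  then have "(\<Prod>j\<in>UNIV. phi_A (monom 1 (Poly_Mapping.lookup m j)) (x $ j)) = 0" for m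
    by (intro prod_zero) auto
  then show ?thesis by (simp only: tensor_map_def mult_zero_right sum.neutral_const)
qed

lemma continuous_on_tensor_log_laplace:
  "continuous_on orthant (tensor_log_laplace \<alpha> (q :: 'a::finite mpoly))"
proof -
  have "continuous_on {0<..} (log_laplace k l)" for k l
    using has_real_derivative_log_laplace
    by (intro continuous_at_imp_continuous_on ballI) (auto intro: DERIV_isCont)
  then have "continuous_on orthant (\<lambda>x :: real ^ 'a. log_laplace k l (x $ j))" for k l j
    by (rule continuous_on_compose2) (auto simp: orthant_def intro!: continuous_intros)
  then show ?thesis unfolding tensor_log_laplace_def lin_ext_def
    by (intro continuous_on_sum continuous_on_mult continuous_on_const continuous_on_prod)
qed

lemma has_real_derivative_tensor_log_laplace:
  assumes x: "x \<in> orthant"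
  shows "((\<lambda>t. tensor_log_laplace \<alpha> q (x + t *\<^sub>R axis i 1)) has_real_derivative
           - tensor_log_laplace (\<alpha>(i := Suc (\<alpha> i))) q x) (at 0)"
proof -
  let ?l = Poly_Mapping.lookup
  have xi: "x $ i > 0" using x by (auto simp: orthant_def)
  have "((\<lambda>t. \<Prod>j\<in>UNIV. log_laplace (\<alpha> j) (?l m j) ((x + t *\<^sub>R axis i 1) $ j)) has_real_derivative
      - (\<Prod>j\<in>UNIV. log_laplace ((\<alpha>(i := Suc (\<alpha> i))) j) (?l m j) (x $ j))) (at 0)" for m
  proof -
    define c where "c = (\<Prod>j\<in>UNIV - {i}. log_laplace (\<alpha> j) (?l m j) (x $ j))"
    have "(\<Prod>j\<in>UNIV - {i}. log_laplace (\<alpha> j) (?l m j) ((x + t *\<^sub>R axis i 1) $ j)) = c" for t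
      unfolding c_def by (intro prod.cong) (auto simp: axis_def)
    then have "(\<Prod>j\<in>UNIV. log_laplace (\<alpha> j) (?l m j) ((x + t *\<^sub>R axis i 1) $ j)) =
        log_laplace (\<alpha> i) (?l m i) (x $ i + t) * c" for t
      by (subst prod.remove[of UNIV i]) (auto simp: axis_def)
    moreover have "(\<Prod>j\<in>UNIV. log_laplace ((\<alpha>(i := Suc (\<alpha> i))) j) (?l m j) (x $ j)) =
        log_laplace (Suc (\<alpha> i)) (?l m i) (x $ i) * c"
      by (subst prod.remove[of UNIV i]) (auto simp: c_def intro!: prod.cong)
    moreover have "((\<lambda>t. log_laplace (\<alpha> i) (?l m i) (x $ i + t) * c) has_real_derivative
        - log_laplace (Suc (\<alpha> i)) (?l m i) (x $ i) * c) (at 0)"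
    proof (rule DERIV_cmult_right)
      show "((\<lambda>t. log_laplace (\<alpha> i) (?l m i) (x $ i + t)) has_real_derivative
          - log_laplace (Suc (\<alpha> i)) (?l m i) (x $ i)) (at 0)"
        using has_real_derivative_log_laplace[OF xi, of "\<alpha> i" "?l m i"]
          DERIV_shift[of "log_laplace (\<alpha> i) (?l m i)" _ 0 "x $ i"] by (simp add: add.commute)
    qed
    ultimately show ?thesis by simp
  qed
  then have "((\<lambda>t. \<Sum>m\<in>Poly_Mapping.keys q. ?l q m *
        (\<Prod>j\<in>UNIV. log_laplace (\<alpha> j) (?l m j) ((x + t *\<^sub>R axis i 1) $ j))) has_real_derivative
      (\<Sum>m\<in>Poly_Mapping.keys q. ?l q m *
        - (\<Prod>j\<in>UNIV. log_laplace ((\<alpha>(i := Suc (\<alpha> i))) j) (?l m j) (x $ j)))) (at 0)"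
    by (intro DERIV_sum DERIV_cmult)
  then show ?thesis by (simp add: tensor_log_laplace_def lin_ext_def sum_negf)
qed

text \<open>\<open>g\<close> is known only on the orthant, which suffices because the orthant is
  open along each axis. The factor \<open>c\<close> is \<open>(-1) ^ length js\<close> for plain
  iterated derivatives and \<open>1\<close> for the alternating ones.\<close>

lemma
  assumes x: "x \<in> orthant" and g: "\<And>x. x \<in> orthant \<Longrightarrow> g x = c * tensor_log_laplace \<alpha> q x"
  shows differentiable_along_axis: "(\<lambda>t. g (x + t *\<^sub>R axis i 1)) field_differentiable (at 0)"
    and partial_deriv_tensor_log_laplace:
      "partial_deriv i g x = - c * tensor_log_laplace (\<alpha>(i := Suc (\<alpha> i))) q x"
proof -
  have "((\<lambda>t. c * tensor_log_laplace \<alpha> q (x + t *\<^sub>R axis i 1)) has_real_derivative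
      c * - tensor_log_laplace (\<alpha>(i := Suc (\<alpha> i))) q x) (at 0)"
    by (intro DERIV_cmult has_real_derivative_tensor_log_laplace x)
  then have "((\<lambda>t. g (x + t *\<^sub>R axis i 1)) has_real_derivative
      c * - tensor_log_laplace (\<alpha>(i := Suc (\<alpha> i))) q x) (at 0)"
  proof (rule has_field_derivative_transform_within_open[where S = "{- x $ i<..}"])
    show "c * tensor_log_laplace \<alpha> q (x + t *\<^sub>R axis i 1) = g (x + t *\<^sub>R axis i 1)" if "t \<in> {- x $ i<..}" for t
      using x that by (intro g[symmetric]) (auto simp: orthant_def axis_def)
  qed (use x in \<open>auto simp: orthant_def\<close>)
  then show "(\<lambda>t. g (x + t *\<^sub>R axis i 1)) field_differentiable (at 0)"
    "partial_deriv i g x = - c * tensor_log_laplace (\<alpha>(i := Suc (\<alpha> i))) q x"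
    by (auto simp: field_differentiable_def partial_deriv_def DERIV_imp_deriv)
qed

lemma smooth_on_tensor_map: "smooth_on orthant (tensor_map phi_A q)"
  unfolding smooth_on_def
proof (intro allI conjI ballI)
  fix js :: "'a list"
  \<comment> \<open>The order of differentiation is forgotten: only the multiplicities
    \<open>count_list js\<close> remain.\<close>
  have eq: "foldr partial_deriv js (tensor_map phi_A q) x =
      (-1) ^ length js * tensor_log_laplace (count_list js) q x" if "x \<in> orthant" for x
    using that
  proof (induction js arbitrary: x)
    case Nil
    then show ?case by (simp add: tensor_map_phi_A)
  next
    case (Cons j js)
    have "(count_list js)(j := Suc (count_list js j)) = count_list (j # js)" by auto
    then show ?case using partial_deriv_tensor_log_laplace[OF Cons.prems Cons.IH, of j]
      by (simp del: count_list.simps)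
  qed
  show "continuous_on orthant (foldr partial_deriv js (tensor_map phi_A q))"
    by (subst continuous_on_cong[OF refl eq]) (auto intro!: continuous_intros continuous_on_tensor_log_laplace)
  show "(\<lambda>t. foldr partial_deriv js (tensor_map phi_A q) (x + t *\<^sub>R axis i 1)) field_differentiable (at 0)"
    if "x \<in> orthant" for i x
    using that eq by (rule differentiable_along_axis)
qed

lemma alt_deriv_tensor_map:
  assumes x: "x \<in> orthant"
  shows "alt_deriv \<alpha> (tensor_map phi_A q) x = tensor_log_laplace \<alpha> q x"
proof -
  let ?D = "\<lambda>i g x. - partial_deriv i g x"
  have pow: "((?D i ^^ n) g) x = tensor_log_laplace (\<beta>(i := \<beta> i + n)) q x"
    if "x \<in> orthant" "\<And>x. x \<in> orthant \<Longrightarrow> g x = tensor_log_laplace \<beta> q x" for i n g \<beta> x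
    using that(1)
  proof (induction n arbitrary: x)
    case 0
    then show ?case using that by simp
  next
    case (Suc n)
    then show ?case
      using partial_deriv_tensor_log_laplace[of x "(?D i ^^ n) g" 1 "\<beta>(i := \<beta> i + n)" q i] by (simp del: fun_upd_apply add: fun_upd_same)
  qed
  have "foldr (\<lambda>i. ?D i ^^ \<alpha> i) js (tensor_map phi_A q) x =
      tensor_log_laplace (\<lambda>i. if i \<in> set js then \<alpha> i else 0) q x"
    if "distinct js" "x \<in> orthant" for js x
    using that
  proof (induction js arbitrary: x)
    case Nil
    then show ?case by (simp add: tensor_map_phi_A)
  next
    case (Cons j js)
    let ?\<beta> = "\<lambda>i. if i \<in> set js then \<alpha> i else 0"
    have "?\<beta>(j := ?\<beta> j + \<alpha> j) = (\<lambda>i. if i \<in> set (j # js) then \<alpha> i else 0)"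
      using Cons.prems by auto
    moreover have "(?D j ^^ \<alpha> j) (foldr (\<lambda>i. ?D i ^^ \<alpha> i) js (tensor_map phi_A q)) x =
        tensor_log_laplace (?\<beta>(j := ?\<beta> j + \<alpha> j)) q x"
      using Cons by (intro pow) auto
    ultimately show ?case by simp
  qed
  moreover have "set (coords :: 'a list) = UNIV \<and> distinct (coords :: 'a list)"
    unfolding coords_def by (rule someI_ex) (use finite_distinct_list[of "UNIV :: 'a set"] in auto)
  ultimately show ?thesis using x by (simp add: alt_deriv_def)
qed

lemma completely_monotone_tensor_map:
  "completely_monotone (tensor_map phi_A q) \<longleftrightarrow> (\<forall>\<alpha>. \<forall>x\<in>orthant. tensor_log_laplace \<alpha> q x \<ge> 0)"
  by (simp add: completely_monotone_def smooth_on_tensor_map alt_deriv_tensor_map)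

text \<open>Integrating one coordinate at a time avoids a multidimensional integral. In
  \<open>E S y\<close> the coordinates in \<open>S\<close> are integrated out and the others are
  evaluated at \<open>y\<close>; inserting \<open>j\<close> integrates \<open>E S\<close>, with
  \<open>ln u\<close> in place of \<open>y j\<close>, against a nonnegative kernel.\<close>

lemma tensor_log_laplace_nonneg:
  fixes q :: "'s::finite mpoly"
  assumes psd: "\<And>y. mpoly_eval q y \<ge> 0" and x: "x \<in> orthant"
  shows "tensor_log_laplace \<alpha> q x \<ge> 0"
proof -
  let ?l = Poly_Mapping.lookup
  define E where "E S y = lin_ext (\<lambda>m. \<Prod>j\<in>UNIV. if j \<in> S then log_laplace (\<alpha> j) (?l m j) (x $ j) else y j ^ ?l m j) q"
    for S :: "'s set" and y
  have "E S y \<ge> 0" for S y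
  proof (induction S arbitrary: y rule: finite_induct[OF finite])
    case 1
    then show ?case using psd[of y] by (simp add: E_def mpoly_eval_lin_ext mono_eval_UNIV[abs_def])
  next
    case (2 j S)
    have xj: "x $ j > 0" using x by (auto simp: orthant_def)
    define c where "c m = (\<Prod>i\<in>UNIV - {j}. if i \<in> S then log_laplace (\<alpha> i) (?l m i) (x $ i) else y i ^ ?l m i)" for m
    have "E (insert j S) y = lin_ext (\<lambda>m. log_laplace (\<alpha> j) (?l m j) (x $ j) * c m) q"
    proof -
      have "(\<Prod>i\<in>UNIV. if i \<in> insert j S then log_laplace (\<alpha> i) (?l m i) (x $ i) else y i ^ ?l m i) =
          log_laplace (\<alpha> j) (?l m j) (x $ j) * c m" for m
        unfolding c_def by (subst prod.remove[of UNIV j]) (auto intro!: prod.cong)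
      then show ?thesis by (simp add: E_def)
    qed
    also have "\<dots> = (\<integral>u. (\<Sum>m\<in>Poly_Mapping.keys q. ?l q m * (log_laplace_kernel (\<alpha> j) (?l m j) (x $ j) u * c m)) \<partial>lborel)"
      using integrable_log_laplace_kernel[OF xj] by (simp add: lin_ext_def log_laplace_def)
    also have "(\<lambda>u. \<Sum>m\<in>Poly_Mapping.keys q. ?l q m * (log_laplace_kernel (\<alpha> j) (?l m j) (x $ j) u * c m)) =
        (\<lambda>u. log_laplace_kernel (\<alpha> j) 0 (x $ j) u * E S (y(j := ln u)))"
    proof
      fix u
      have "(\<Prod>i\<in>UNIV. if i \<in> S then log_laplace (\<alpha> i) (?l m i) (x $ i) else (y(j := ln u)) i ^ ?l m i) =
          ln u ^ ?l m j * c m" for m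
      proof -
        have "(\<Prod>i\<in>UNIV - {j}. if i \<in> S then log_laplace (\<alpha> i) (?l m i) (x $ i) else (y(j := ln u)) i ^ ?l m i) = c m"
          unfolding c_def by (intro prod.cong) auto
        then show ?thesis using 2(2) by (subst prod.remove[of UNIV j]) auto
      qed
      then show "(\<Sum>m\<in>Poly_Mapping.keys q. ?l q m * (log_laplace_kernel (\<alpha> j) (?l m j) (x $ j) u * c m)) =
          log_laplace_kernel (\<alpha> j) 0 (x $ j) u * E S (y(j := ln u))"
        by (simp add: E_def lin_ext_def log_laplace_kernel_def sum_distrib_left mult_ac)
    qed
    also have "(\<integral>u. log_laplace_kernel (\<alpha> j) 0 (x $ j) u * E S (y(j := ln u)) \<partial>lborel) \<ge> 0"
      using 2 by (intro Bochner_Integration.integral_nonneg mult_nonneg_nonneg)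
        (auto simp: log_laplace_kernel_def indicator_def)
    finally show ?case .
  qed
  \<comment> \<open>All coordinates are integrated out, so the choice of \<open>y\<close> is
    immaterial.\<close>
  from this[of UNIV undefined] show ?thesis by (simp add: E_def tensor_log_laplace_def)
qed

text \<open>Each monomial is a product over the coordinates, so the one-variable concentration
  applies factor by factor.\<close>

lemma tensor_log_laplace_limit:
  fixes q :: "'s::finite mpoly" and y :: "'s \<Rightarrow> real"
  defines "x \<equiv> \<lambda>k. \<chi> j. real k * exp (- y j)"
  shows "(\<lambda>k. (\<Prod>j\<in>UNIV. (x k $ j) ^ Suc k / fact k) * tensor_log_laplace (\<lambda>_. k) q (x k))
      \<longlonglongrightarrow> mpoly_eval q y"
proof -
  let ?l = Poly_Mapping.lookup
  have "(\<lambda>k. \<Sum>m\<in>Poly_Mapping.keys q. ?l q m *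
      (\<Prod>j\<in>UNIV. (x k $ j) ^ Suc k / fact k * log_laplace k (?l m j) (x k $ j)))
      \<longlonglongrightarrow> (\<Sum>m\<in>Poly_Mapping.keys q. ?l q m * (\<Prod>j\<in>UNIV. y j ^ ?l m j))"
    unfolding x_def vec_lambda_beta by (intro tendsto_sum tendsto_mult_left tendsto_prod log_laplace_concentrates)
  moreover have "(\<Prod>j\<in>UNIV. (x k $ j) ^ Suc k / fact k) * tensor_log_laplace (\<lambda>_. k) q (x k) =
      (\<Sum>m\<in>Poly_Mapping.keys q. ?l q m *
      (\<Prod>j\<in>UNIV. (x k $ j) ^ Suc k / fact k * log_laplace k (?l m j) (x k $ j)))" for k
    unfolding tensor_log_laplace_def lin_ext_def prod.distrib sum_distrib_left by (simp add: mult_ac)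
  ultimately show ?thesis by (simp add: mpoly_eval_lin_ext lin_ext_def mono_eval_UNIV)
qed

lemma mpoly_eval_nonneg_if_tensor_log_laplace_nonneg:
  fixes q :: "'s::finite mpoly"
  assumes "\<And>\<alpha> x. x \<in> orthant \<Longrightarrow> tensor_log_laplace \<alpha> q x \<ge> 0"
  shows "mpoly_eval q y \<ge> 0"
proof (rule LIMSEQ_le_const[OF tensor_log_laplace_limit], intro exI allI impI)
  \<comment> \<open>For \<open>k = 0\<close> the point is the origin, which is not in the
    orthant.\<close>
  fix k :: nat assume "k \<ge> 1"
  then have "(\<chi> j. real k * exp (- y j)) \<in> (orthant :: (real ^ 's) set)" by (auto simp: orthant_def)
  then show "0 \<le> (\<Prod>j\<in>UNIV. ((\<chi> j. real k * exp (- y j)) $ j) ^ Suc k / fact k) *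
      tensor_log_laplace (\<lambda>_. k) q (\<chi> j. real k * exp (- y j))"
    by (intro mult_nonneg_nonneg prod_nonneg assms) auto
qed

lemma completely_monotone_tensor_map_iff:
  "completely_monotone (tensor_map phi_A q) \<longleftrightarrow> (\<forall>y. mpoly_eval q y \<ge> 0)"
  using tensor_log_laplace_nonneg mpoly_eval_nonneg_if_tensor_log_laplace_nonneg
  unfolding completely_monotone_tensor_map by blast

lemma tensor_map_phi_A_inj:
  fixes p q :: "'s::finite mpoly"
  assumes "tensor_map phi_A p = tensor_map phi_A q"
  shows "p = q"
proof (rule mpoly_eval_inj)
  fix y :: "'s \<Rightarrow> real"
  have "tensor_log_laplace \<alpha> p x = tensor_log_laplace \<alpha> q x" if "x \<in> orthant" for \<alpha> x
    using alt_deriv_tensor_map[OF that, of \<alpha> p] alt_deriv_tensor_map[OF that, of \<alpha> q] assms by simp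
  then have "\<forall>\<^sub>F k in sequentially. tensor_log_laplace (\<lambda>_. k) p (\<chi> j. real k * exp (- y j)) =
      tensor_log_laplace (\<lambda>_. k) q (\<chi> j. real k * exp (- y j))"
    by (intro eventually_sequentiallyI[of 1]) (auto simp: orthant_def)
  then show "mpoly_eval p y = mpoly_eval q y"
    by (intro LIMSEQ_unique[OF tensor_log_laplace_limit Lim_transform_eventually[OF tensor_log_laplace_limit]])
      (auto elim: eventually_mono)
qed

section \<open>Surjectivity of the tensor map onto the function space\<close>

text \<open>\<open>phi_A (monom 1 l)\<close> has top term \<open>(-1) ^ l * ln x ^ l / x\<close>,
  because \<open>Gamma 1 = 1\<close>. Solving for this term leaves lower powers, to which strong
  induction applies.\<close>

lemma log_power_in_span_phi_A:
  "\<exists>c. \<forall>x>0. ln x ^ l / x = (\<Sum>r\<le>l. c r * phi_A (monom 1 r) x)"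
proof (induction l rule: less_induct)
  case (less l)
  then obtain C where C: "\<And>m x. m < l \<Longrightarrow> x > 0 \<Longrightarrow> ln x ^ m / x = (\<Sum>r\<le>m. C m r * phi_A (monom 1 r) x)"
    by metis
  define b where "b m = (-1) ^ m * real (l choose m) * gamma_deriv (l - m)" for m
  define d where "d r = (-1) ^ l * ((if r = l then 1 else 0) - (\<Sum>m<l. b m * (if r \<le> m then C m r else 0)))" for r
  have "ln x ^ l / x = (\<Sum>r\<le>l. d r * phi_A (monom 1 r) x)" if "x > 0" for x
  proof -
    have low: "(\<Sum>m<l. b m * (ln x ^ m / x)) =
        (\<Sum>r\<le>l. (\<Sum>m<l. b m * (if r \<le> m then C m r else 0)) * phi_A (monom 1 r) x)"
    proof -
      have "ln x ^ m / x = (\<Sum>r\<le>l. (if r \<le> m then C m r else 0) * phi_A (monom 1 r) x)" if "m < l" for m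
        unfolding C[OF that \<open>x > 0\<close>] using that by (intro sum.mono_neutral_cong_left) auto
      then have "(\<Sum>m<l. b m * (ln x ^ m / x)) =
          (\<Sum>m<l. \<Sum>r\<le>l. b m * (if r \<le> m then C m r else 0) * phi_A (monom 1 r) x)"
        by (intro sum.cong) (auto simp: sum_distrib_left mult.assoc)
      also have "\<dots> = (\<Sum>r\<le>l. \<Sum>m<l. b m * (if r \<le> m then C m r else 0) * phi_A (monom 1 r) x)"
        by (rule sum.swap)
      finally show ?thesis by (simp add: sum_distrib_right)
    qed
    have "phi_A (monom 1 l) x = (\<Sum>m<l. b m * (ln x ^ m / x)) + b l * (ln x ^ l / x)"
      using that by (simp add: phi_A_monom b_def lessThan_Suc_atMost[symmetric])
    moreover have "b l = (-1) ^ l" by (simp add: b_def gamma_deriv_def)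
    ultimately have "(-1) ^ l * (ln x ^ l / x) = phi_A (monom 1 l) x - (\<Sum>m<l. b m * (ln x ^ m / x))" by simp
    moreover have "(-1) ^ l * ((-1) ^ l * (ln x ^ l / x)) = ln x ^ l / x"
      by (simp flip: mult.assoc power_mult_distrib)
    ultimately have "ln x ^ l / x = (-1) ^ l * (phi_A (monom 1 l) x - (\<Sum>m<l. b m * (ln x ^ m / x)))" by metis
    also have "phi_A (monom 1 l) x = (\<Sum>r\<le>l. (if r = l then 1 else 0) * phi_A (monom 1 r) x)"
      by (simp add: if_distrib[of "\<lambda>c. c * _"] cong: if_cong)
    also have "(-1) ^ l * (\<dots> - (\<Sum>m<l. b m * (ln x ^ m / x))) = (\<Sum>r\<le>l. d r * phi_A (monom 1 r) x)"
      unfolding low d_def by (simp only: sum_subtractf[symmetric] left_diff_distrib[symmetric] sum_distrib_left mult.assoc)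
    finally show ?thesis .
  qed
  then show ?case by blast
qed

lemma log_fun_lin_ext: "log_fun p x = lin_ext (\<lambda>m. log_fun (Poly_Mapping.single m 1) x) p"
  by (cases "x \<in> orthant")
    (simp_all add: log_fun_def mpoly_eval_lin_ext lin_ext_def sum_divide_distrib)

text \<open>The one-variable expansions are multiplied out. Only exponent vectors bounded by that of
  \<open>m\<close> occur, so the total degree does not grow.\<close>

lemma log_fun_single_in_range:
  fixes m :: "'s::finite \<Rightarrow>\<^sub>0 nat"
  assumes "mono_degree m \<le> n"
  shows "\<exists>q\<in>mpolys_le n. tensor_map phi_A q = log_fun (Poly_Mapping.single m 1)"
proof -
  let ?l = Poly_Mapping.lookup
  obtain c where c: "\<And>l x. x > 0 \<Longrightarrow> ln x ^ l / x = (\<Sum>r\<le>l. c l r * phi_A (monom 1 r) x)"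
    using log_power_in_span_phi_A by metis
  define mon :: "('s \<Rightarrow> nat) \<Rightarrow> 's \<Rightarrow>\<^sub>0 nat" where "mon = Poly_Mapping.Abs_poly_mapping"
  have lookup_mon: "?l (mon g) = g" for g by (simp add: mon_def)
  define G where "G = (\<Pi>\<^sub>E j\<in>UNIV. {..?l m j})"
  define q where "q = (\<Sum>g\<in>G. Poly_Mapping.single (mon g) (\<Prod>j\<in>UNIV. c (?l m j) (g j)))"
  have "mono_degree (mon g) \<le> n" if "g \<in> G" for g
  proof -
    have "mono_degree (mon g) \<le> mono_degree m"
      unfolding mono_degree_UNIV lookup_mon using that by (intro sum_mono) (auto simp: G_def)
    then show ?thesis using assms by simp
  qed
  then have "q \<in> mpolys_le n" unfolding q_def by (intro mpolys_le_sum mpolys_le_single)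
  moreover have "tensor_map phi_A q x = log_fun (Poly_Mapping.single m 1) x" for x
  proof (cases "x \<in> orthant")
    case True
    then have pos: "x $ j > 0" for j by (auto simp: orthant_def)
    have "log_fun (Poly_Mapping.single m 1) x = (\<Prod>j\<in>UNIV. ln (x $ j) ^ ?l m j / x $ j)"
      using True by (simp add: log_fun_def mpoly_eval_lin_ext mono_eval_UNIV prod_dividef)
    also have "\<dots> = (\<Prod>j\<in>UNIV. \<Sum>r\<le>?l m j. c (?l m j) r * phi_A (monom 1 r) (x $ j))"
      using c[OF pos] by simp
    also have "\<dots> = (\<Sum>g\<in>G. \<Prod>j\<in>UNIV. c (?l m j) (g j) * phi_A (monom 1 (g j)) (x $ j))"
      unfolding G_def by (rule prod_sum_PiE) auto
    also have "\<dots> = tensor_map phi_A q x"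
      by (simp add: tensor_map_lin_ext q_def lin_ext_sum lookup_mon prod.distrib)
    finally show ?thesis by simp
  qed (simp add: tensor_map_phi_A_outside log_fun_def)
  ultimately show ?thesis by blast
qed

section \<open>Nonnegativity as a sign condition on the parameters\<close>

lemma polyfun_case_sum:
  assumes "f \<in> polyfun (Inl ` I)"
  shows "(\<lambda>a. f (case_sum a (\<lambda>_. 0))) \<in> polyfun I"
  using assms by induction (auto intro: polyfun.intros)

text \<open>Elimination runs over a sum type, with the parameters on the left and the bound
  variables on the right. Once the latter are eliminated, filling their places with zeros returns to
  functions of the parameters alone.\<close>

lemma sign_determined_case_sum:
  assumes "pf.sign_determined (Inl ` I) T"
  shows "pf.sign_determined I {a. case_sum a (\<lambda>_. 0) \<in> T}"
proof -
  obtain C where C: "finite C" "C \<subseteq> polyfun (Inl ` I)"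
    "\<And>x y. pf.same_signs C x y \<Longrightarrow> x \<in> T \<Longrightarrow> y \<in> T"
    using assms unfolding pf.sign_determined_def by blast
  let ?C = "(\<lambda>f a. f (case_sum a (\<lambda>_. 0))) ` C"
  have "?C \<subseteq> polyfun I"
  proof (rule image_subsetI)
    fix f assume "f \<in> C"
    then have "f \<in> polyfun (Inl ` I)" using C(2) by blast
    then show "(\<lambda>a. f (case_sum a (\<lambda>_. 0))) \<in> polyfun I" by (rule polyfun_case_sum)
  qed
  moreover have "case_sum b (\<lambda>_. 0) \<in> T"
    if "pf.same_signs ?C a b" "case_sum a (\<lambda>_. 0) \<in> T" for a b
  proof (rule C(3)[OF _ that(2)])
    show "pf.same_signs C (case_sum a (\<lambda>_. 0)) (case_sum b (\<lambda>_. 0))"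
      using that(1) by (simp add: pf.same_signs_def)
  qed
  moreover have "finite ?C" using C(1) by simp
  ultimately show ?thesis
    unfolding pf.sign_determined_def mem_Collect_eq by (intro exI[of _ ?C] conjI allI impI)
qed

text \<open>Homogenisation with an extra variable turns a quantifier over the whole space into one over
  the cube; the exponent leaves a positive power of that variable, so its zero is harmless.\<close>

lemma sign_determined_nonneg:
  fixes q :: "'i \<Rightarrow> 's::finite mpoly"
  assumes I: "finite I" and q: "\<And>i. i \<in> I \<Longrightarrow> q i \<in> mpolys_le n"
  shows "pf.sign_determined I {a. \<forall>y. (\<Sum>i\<in>I. a i * mpoly_eval (q i) y) \<ge> 0}"
proof -
  let ?l = Poly_Mapping.lookup
  \<comment> \<open>Even, so that the factor \<open>v ^ N\<close> preserves signs also for negative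
    \<open>v\<close>; larger than \<open>n\<close>, so that every exponent
    \<open>N - mono_degree m\<close> is positive. The homogenising variable is
    \<open>Inr None\<close>.\<close>
  define N where "N = 2 * n + 2"
  define F :: "(('i + 's option) \<Rightarrow> real) \<Rightarrow> real" where
    "F b = (\<Sum>i\<in>I. b (Inl i) * (\<Sum>m\<in>Poly_Mapping.keys (q i). ?l (q i) m *
        ((\<Prod>j\<in>UNIV. b (Inr (Some j)) ^ ?l m j) * b (Inr None) ^ (N - mono_degree m))))" for b
  define Y :: "('i + 's option) set" where "Y = Inr ` UNIV"
  define V where "V = Inl ` I \<union> Y"
  have deg: "mono_degree m \<le> n" if "i \<in> I" "m \<in> Poly_Mapping.keys (q i)" for i m
    using q that by (auto simp: mpolys_le_def)
  have F: "F b = v ^ N * (\<Sum>i\<in>I. b (Inl i) * mpoly_eval (q i) y)"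
    if v: "b (Inr None) = v" "v \<noteq> 0" and w: "\<And>j. b (Inr (Some j)) = v * y j" for b v y
  proof -
    have "(\<Prod>j\<in>UNIV. b (Inr (Some j)) ^ ?l m j) * b (Inr None) ^ (N - mono_degree m) = v ^ N * mono_eval y m"
      if "i \<in> I" "m \<in> Poly_Mapping.keys (q i)" for i m
    proof -
      have "v ^ N = v ^ mono_degree m * v ^ (N - mono_degree m)"
        using deg[OF that] by (simp add: N_def flip: power_add)
      moreover have "(\<Prod>j\<in>UNIV. b (Inr (Some j)) ^ ?l m j) = v ^ mono_degree m * mono_eval y m"
        by (simp add: w power_mult_distrib prod.distrib mono_eval_UNIV mono_degree_UNIV power_sum)
      ultimately show ?thesis by (simp only: v mult_ac)
    qed
    then have "F b = (\<Sum>i\<in>I. b (Inl i) * (\<Sum>m\<in>Poly_Mapping.keys (q i). ?l (q i) m * (v ^ N * mono_eval y m)))"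
      unfolding F_def by simp
    then show ?thesis by (simp add: mpoly_eval_lin_ext lin_ext_def sum_distrib_left mult_ac)
  qed
  have "F \<in> polyfun V"
    unfolding F_def by (intro pf.sum_mem polyfun.mult polyfun.const polyfun_prod polyfun_power polyfun.var)
      (auto simp: V_def Y_def)
  then have "pf.sign_determined V {b. F b \<ge> 0}"
    unfolding pf.sign_determined_def pf.same_signs_def
    by (intro exI[of _ "{F}"]) (auto simp: sgn_real_def split: if_splits)
  then have "pf.sign_determined (V - Y)
      {b. \<forall>\<tau>. (\<forall>v\<in>Y. \<tau> v \<in> {-1..1}) \<longrightarrow> (\<lambda>v. if v \<in> Y then \<tau> v else b v) \<in> {b. F b \<ge> 0}}"
    by (rule sign_determined_forall_finite) (simp add: Y_def)
  also have "V - Y = Inl ` I" by (auto simp: V_def Y_def)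
  finally have "pf.sign_determined I {a. case_sum a (\<lambda>_. 0) \<in>
      {b. \<forall>\<tau>. (\<forall>v\<in>Y. \<tau> v \<in> {-1..1}) \<longrightarrow> (\<lambda>v. if v \<in> Y then \<tau> v else b v) \<in> {b. F b \<ge> 0}}}"
    by (rule sign_determined_case_sum)
  also have "{a. case_sum a (\<lambda>_. 0) \<in>
      {b. \<forall>\<tau>. (\<forall>v\<in>Y. \<tau> v \<in> {-1..1}) \<longrightarrow> (\<lambda>v. if v \<in> Y then \<tau> v else b v) \<in> {b. F b \<ge> 0}}} =
      {a. \<forall>y. (\<Sum>i\<in>I. a i * mpoly_eval (q i) y) \<ge> 0}"
  proof (intro Collect_cong iffI allI)
    fix a :: "'i \<Rightarrow> real" and y :: "'s \<Rightarrow> real"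
    assume a: "case_sum a (\<lambda>_. 0) \<in> {b. \<forall>\<tau>. (\<forall>v\<in>Y. \<tau> v \<in> {-1..1}) \<longrightarrow>
        (\<lambda>v. if v \<in> Y then \<tau> v else b v) \<in> {b. F b \<ge> 0}}"
    define r where "r = (\<Sum>j\<in>UNIV. \<bar>y j\<bar>)"
    \<comment> \<open>This factor brings the homogeneous point with coordinates \<open>v\<close> and
      \<open>v * y j\<close> into the cube.\<close>
    define v where "v = 1 / (1 + r)"
    have s: "r \<ge> 0" unfolding r_def by (rule sum_nonneg) auto
    have v: "v > 0" "v \<le> 1" using s by (auto simp: v_def)
    have vy: "\<bar>v * y j\<bar> \<le> 1" for j
    proof -
      have "\<bar>y j\<bar> \<le> r" unfolding r_def by (rule member_le_sum) auto
      then show ?thesis using s by (simp add: v_def abs_mult field_simps)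
    qed
    define \<tau> where "\<tau> = case_sum (\<lambda>_ :: 'i. 0) (case_option v (\<lambda>j. v * y j))"
    define b where "b = (\<lambda>u. if u \<in> Y then \<tau> u else case_sum a (\<lambda>_. 0) u)"
    have "\<forall>u\<in>Y. \<tau> u \<in> {-1..1}"
      using v vy by (auto simp: Y_def \<tau>_def abs_le_iff split: option.split)
    then have "F b \<ge> 0" using a unfolding b_def by blast
    moreover have "F b = v ^ N * (\<Sum>i\<in>I. b (Inl i) * mpoly_eval (q i) y)"
      using v by (intro F) (auto simp: b_def Y_def \<tau>_def)
    moreover have "b (Inl i) = a i" for i by (auto simp: b_def Y_def)
    ultimately show "(\<Sum>i\<in>I. a i * mpoly_eval (q i) y) \<ge> 0"
      using zero_less_power[OF v(1), of N] by (simp add: zero_le_mult_iff)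
  next
    fix a :: "'i \<Rightarrow> real"
    assume a: "\<forall>y. (\<Sum>i\<in>I. a i * mpoly_eval (q i) y) \<ge> 0"
    have nonneg: "F b \<ge> 0" if "\<And>i. b (Inl i) = a i" for b
    proof (cases "b (Inr None) = 0")
      case True
      have "b (Inr None) ^ (N - mono_degree m) = 0" if "i \<in> I" "m \<in> Poly_Mapping.keys (q i)" for i m
        using deg[OF that] True by (simp add: N_def)
      then have "(\<Sum>m\<in>Poly_Mapping.keys (q i). ?l (q i) m *
        ((\<Prod>j\<in>UNIV. b (Inr (Some j)) ^ ?l m j) * b (Inr None) ^ (N - mono_degree m))) = 0" if "i \<in> I" for i
        using that by (intro sum.neutral ballI) (simp only: mult_zero_right)
      then show ?thesis by (simp add: F_def)
    next
      case False
      then have "F b = b (Inr None) ^ N * (\<Sum>i\<in>I. b (Inl i) * mpoly_eval (q i) (\<lambda>j. b (Inr (Some j)) / b (Inr None)))"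
        by (intro F) auto
      moreover have "b (Inr None) ^ N \<ge> 0" by (rule zero_le_even_power) (simp add: N_def)
      ultimately show ?thesis using a that by simp
    qed
    then show "case_sum a (\<lambda>_. 0) \<in> {b. \<forall>\<tau>. (\<forall>v\<in>Y. \<tau> v \<in> {-1..1}) \<longrightarrow>
        (\<lambda>v. if v \<in> Y then \<tau> v else b v) \<in> {b. F b \<ge> 0}}"
      by (intro CollectI allI impI nonneg) (auto simp: Y_def)
  qed
  finally show ?thesis .
qed

section \<open>The cone of completely monotone functions in coefficient coordinates\<close>

theorem theorem1p4:
  fixes n :: nat
  shows "(\<forall>f \<in> (log_space n :: (real ^ 's::finite \<Rightarrow> real) set).
            completely_monotone f \<longleftrightarrow>
            inv_into (mpolys_le n) (tensor_map phi_A) f \<in> Psd n)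
       \<and> (\<exists>B. finite B \<and> span B = (log_space n :: (real ^ 's \<Rightarrow> real) set))
       \<and> convex_cone (CM n :: (real ^ 's \<Rightarrow> real) set)
       \<and> semialgebraic_in_log_space n (CM n :: (real ^ 's \<Rightarrow> real) set)"
proof -
  let ?l = Poly_Mapping.lookup
  define I where "I = {m :: 's \<Rightarrow>\<^sub>0 nat. mono_degree m \<le> n}"
  have finI: "finite I" unfolding I_def by (rule finite_mono_degree_le)
  have keys_I: "Poly_Mapping.keys p \<subseteq> I" if "p \<in> mpolys_le n" for p
    using that by (auto simp: mpolys_le_def I_def)
  have "\<forall>m\<in>I. \<exists>q. q \<in> mpolys_le n \<and> tensor_map phi_A q = log_fun (Poly_Mapping.single m 1)"
    using log_fun_single_in_range[of _ n] unfolding I_def Bex_def by blast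
  from bchoice[OF this] obtain Q
    where "\<forall>m\<in>I. Q m \<in> mpolys_le n \<and> tensor_map phi_A (Q m) = log_fun (Poly_Mapping.single m 1)" ..
  then have Q: "\<And>m. m \<in> I \<Longrightarrow> Q m \<in> mpolys_le n"
    "\<And>m. m \<in> I \<Longrightarrow> tensor_map phi_A (Q m) = log_fun (Poly_Mapping.single m 1)"
    by blast+
  \<comment> \<open>The preimage of \<open>log_fun p\<close> under the tensor map, linear in the
    coefficients of \<open>p\<close>; through it nonnegativity of the preimage becomes a condition
    on the coordinates of \<open>log_fun p\<close>.\<close>
  define U where "U p = (\<Sum>m\<in>I. mpoly_scale (?l p m) (Q m))" for p
  have U_le: "U p \<in> mpolys_le n" for p
    unfolding U_def by (intro mpolys_le_sum mpolys_le_scale Q)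
  have U: "tensor_map phi_A (U p) = log_fun p" if "p \<in> mpolys_le n" for p
  proof
    fix x
    have "tensor_map phi_A (U p) x = (\<Sum>m\<in>I. ?l p m * tensor_map phi_A (Q m) x)"
      by (simp add: tensor_map_lin_ext U_def lin_ext_sum lin_ext_mpoly_scale)
    also have "\<dots> = lin_ext (\<lambda>m. log_fun (Poly_Mapping.single m 1) x) p"
      using Q(2) by (simp add: lin_ext_eq_sum[OF finI keys_I[OF that]])
    finally show "tensor_map phi_A (U p) x = log_fun p x" using log_fun_lin_ext[of p x] by simp
  qed
  have eval_U: "mpoly_eval (U p) y = (\<Sum>m\<in>I. ?l p m * mpoly_eval (Q m) y)" for p y
    by (simp add: mpoly_eval_lin_ext U_def lin_ext_sum lin_ext_mpoly_scale)
  have inv: "inv_into (mpolys_le n) (tensor_map phi_A) (log_fun p) = U p" if "p \<in> mpolys_le n" for p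
    unfolding U[OF that, symmetric] using U_le
    by (intro inv_into_f_f) (auto intro: inj_onI tensor_map_phi_A_inj)
  have cm: "completely_monotone (log_fun p) \<longleftrightarrow> (\<forall>y. mpoly_eval (U p) y \<ge> 0)" if "p \<in> mpolys_le n" for p
    using completely_monotone_tensor_map_iff[of "U p"] U[OF that] by simp
  have psd: "U p \<in> Psd n \<longleftrightarrow> (\<forall>y. mpoly_eval (U p) y \<ge> 0)" for p
  proof -
    have "(\<forall>y :: real ^ 's. mpoly_eval (U p) (\<lambda>i. y $ i) \<ge> 0) \<longleftrightarrow> (\<forall>y. mpoly_eval (U p) y \<ge> 0)"
    proof (intro iffI allI)
      fix y :: "'s \<Rightarrow> real"
      assume "\<forall>y :: real ^ 's. mpoly_eval (U p) (\<lambda>i. y $ i) \<ge> 0"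
      from this[rule_format, of "\<chi> i. y i"] show "mpoly_eval (U p) y \<ge> 0"
        by (simp add: vec_lambda_inverse)
    qed auto
    then show ?thesis using U_le by (simp add: Psd_def)
  qed

  have log_add: "log_fun (p + q) = log_fun p + log_fun q" for p q :: "'s mpoly"
    by (rule ext) (simp add: log_fun_lin_ext[of p] log_fun_lin_ext[of q] log_fun_lin_ext[of "p + q"] lin_ext_add)
  have log_scale: "log_fun (mpoly_scale c p) = c *\<^sub>R log_fun p" for c and p :: "'s mpoly"
    by (rule ext) (simp add: scaleR_fun_def log_fun_lin_ext[of p] log_fun_lin_ext[of "mpoly_scale c p"] lin_ext_mpoly_scale)
  have log_zero: "log_fun (0 :: 's mpoly) = 0"
    by (rule ext) (simp add: log_fun_lin_ext[of 0])

  have 1: "\<forall>f \<in> (log_space n :: (real ^ 's \<Rightarrow> real) set). completely_monotone f \<longleftrightarrow>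
      inv_into (mpolys_le n) (tensor_map phi_A) f \<in> Psd n"
    by (auto simp: log_space_def inv cm psd)

  define B where "B = (\<lambda>m. log_fun (Poly_Mapping.single m 1)) ` I"
  have "span B = (log_space n :: (real ^ 's \<Rightarrow> real) set)"
  proof
    have "subspace (log_space n :: (real ^ 's \<Rightarrow> real) set)"
      unfolding subspace_def log_space_def
      by (auto simp flip: log_add log_scale log_zero
          intro!: imageI mpolys_le_zero mpolys_le_add mpolys_le_scale)
    then show "span B \<subseteq> log_space n"
      by (intro span_minimal) (auto simp: B_def I_def log_space_def mpolys_le_single)
    show "log_space n \<subseteq> span B"
    proof
      fix f :: "real ^ 's \<Rightarrow> real" assume "f \<in> log_space n"
      then obtain p where p: "p \<in> mpolys_le n" "f = log_fun p" by (auto simp: log_space_def)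
      have "f = (\<Sum>m\<in>I. ?l p m *\<^sub>R log_fun (Poly_Mapping.single m 1))"
      proof
        fix x
        have "(\<Sum>m\<in>J. ?l p m *\<^sub>R log_fun (Poly_Mapping.single m 1)) x =
            (\<Sum>m\<in>J. ?l p m * log_fun (Poly_Mapping.single m 1) x)" if "finite J" for J
          using that by (induction J) (auto simp: scaleR_fun_def)
        then show "f x = (\<Sum>m\<in>I. ?l p m *\<^sub>R log_fun (Poly_Mapping.single m 1)) x"
          using finI p(2) log_fun_lin_ext[of p x] lin_ext_eq_sum[OF finI keys_I[OF p(1)]] by simp
      qed
      also have "\<dots> \<in> span B"
        by (intro span_sum span_scale span_base) (auto simp: B_def)
      finally show "f \<in> span B" .
    qed
  qed
  then have 2: "\<exists>B. finite B \<and> span B = (log_space n :: (real ^ 's \<Rightarrow> real) set)"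
    using finI by (intro exI[of _ B]) (auto simp: B_def)

  have CM_iff: "log_fun p \<in> CM n \<longleftrightarrow> (\<forall>y. (\<Sum>m\<in>I. ?l p m * mpoly_eval (Q m) y) \<ge> 0)"
    if "p \<in> mpolys_le n" for p
    using that cm[OF that] by (auto simp: CM_def log_space_def eval_U)
  have CM_D: "\<exists>p\<in>mpolys_le n. f = log_fun p" if "f \<in> (CM n :: (real ^ 's \<Rightarrow> real) set)" for f
    using that by (auto simp: CM_def log_space_def)
  have 3: "convex_cone (CM n :: (real ^ 's \<Rightarrow> real) set)"
    unfolding convex_cone_iff
  proof (intro conjI ballI allI impI)
    show "0 \<in> (CM n :: (real ^ 's \<Rightarrow> real) set)"
      using CM_iff[OF mpolys_le_zero] by (simp add: log_zero)
    fix f :: "real ^ 's \<Rightarrow> real" assume f: "f \<in> CM n"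
    then obtain p where p: "p \<in> mpolys_le n" "f = log_fun p" using CM_D by blast
    show "c *\<^sub>R f \<in> CM n" if "c \<ge> 0" for c
    proof -
      have "(\<Sum>m\<in>I. c * ?l p m * mpoly_eval (Q m) y) = c * (\<Sum>m\<in>I. ?l p m * mpoly_eval (Q m) y)" for y
        by (simp add: sum_distrib_left mult.assoc)
      then show ?thesis using f p that CM_iff[OF p(1)] CM_iff[OF mpolys_le_scale[OF p(1)], of c]
        by (simp add: log_scale)
    qed
    fix g :: "real ^ 's \<Rightarrow> real" assume g: "g \<in> CM n"
    then obtain q where q: "q \<in> mpolys_le n" "g = log_fun q" using CM_D by blast
    have "(\<Sum>m\<in>I. (?l p m + ?l q m) * mpoly_eval (Q m) y) =
        (\<Sum>m\<in>I. ?l p m * mpoly_eval (Q m) y) + (\<Sum>m\<in>I. ?l q m * mpoly_eval (Q m) y)" for y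
      by (simp add: distrib_right sum.distrib)
    then show "f + g \<in> CM n"
      using f g p q CM_iff[OF p(1)] CM_iff[OF q(1)] CM_iff[OF mpolys_le_add[OF p(1) q(1)]]
      by (simp add: log_add lookup_add)
  qed

  define S where "S = {a. \<forall>y. (\<Sum>m\<in>I. a m * mpoly_eval (Q m) y) \<ge> 0}"
  have "?l ` {p \<in> mpolys_le n. log_fun p \<in> (CM n :: (real ^ 's \<Rightarrow> real) set)} =
      {a \<in> S. \<forall>v. v \<notin> I \<longrightarrow> a v = 0}"
  proof (intro equalityI subsetI)
    fix a assume "a \<in> ?l ` {p \<in> mpolys_le n. log_fun p \<in> (CM n :: (real ^ 's \<Rightarrow> real) set)}"
    then obtain p where p: "p \<in> mpolys_le n" "log_fun p \<in> (CM n :: (real ^ 's \<Rightarrow> real) set)" "a = ?l p" by blast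
    then show "a \<in> {a \<in> S. \<forall>v. v \<notin> I \<longrightarrow> a v = 0}"
      using CM_iff[OF p(1)] keys_I[OF p(1)] by (auto simp: S_def in_keys_iff)
  next
    fix a assume a: "a \<in> {a \<in> S. \<forall>v. v \<notin> I \<longrightarrow> a v = 0}"
    define p where "p = Poly_Mapping.Abs_poly_mapping a"
    have "finite {v. a v \<noteq> 0}" using a finI by (auto intro: finite_subset[of _ I])
    then have lp: "?l p = a" by (simp add: p_def)
    then have "p \<in> mpolys_le n" using a by (auto simp: mpolys_le_def in_keys_iff I_def)
    moreover from this have "log_fun p \<in> (CM n :: (real ^ 's \<Rightarrow> real) set)"
      using CM_iff a lp by (simp add: S_def)
    ultimately show "a \<in> ?l ` {p \<in> mpolys_le n. log_fun p \<in> (CM n :: (real ^ 's \<Rightarrow> real) set)}"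
      using lp by (intro image_eqI[where x = p]) auto
  qed
  moreover have "pf.sign_determined I S"
    unfolding S_def using finI Q(1) by (rule sign_determined_nonneg)
  ultimately have 4: "semialgebraic_in_log_space n (CM n :: (real ^ 's \<Rightarrow> real) set)"
    using semialgebraic_on_if_sign_determined[of I S]
    by (auto simp: semialgebraic_in_log_space_def I_def CM_def)
  show ?thesis using 1 2 3 4 by blast
qed

end
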